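(* There is an adjunction $\mathsf{cone}\dashv\mathsf{rel}$ between the functors $\mathsf{cone}\colon \mathbf{rocLoc}\to \mathbf{ConFrm}^{\mathrm{op}}$, given by $(X,R)\mapsto(\mathcal{O}X,\Uparrow_R,\Downarrow_R)$, $f\mapsto f^{-1}$, and $\mathsf{rel}\colon \mathbf{ConFrm}^{\mathrm{op}}\to\mathbf{rocLoc}$, given by $(\mathcal{O}X,\mathsf{u},\mathsf{d})\mapsto (X,R_{\mathsf{u},\mathsf{d}})$, $f^{-1}\mapsto f$, whose counit is the identity natural transformation (with $\mathsf{cone}\circ\mathsf{rel}=\mathrm{id}$).
   Context: Frames and locales. A frame is a complete lattice (order $\sqsubseteq$, top $\top$, bottom $\bot$) in which $x\wedge\bigvee y_i=\bigvee (x\wedge y_i)$; frame maps preserve finite meets and all joins. The category of locales is the opposite of the category of frames: a locale $X$ has a frame of opens $\mathcal{O}X$, and a map $f\colon X\to Y$ is a frame map $f^{-1}\colon\mathcal{O}Y\to\mathcal{O}X$. $L\otimes M$ is the coproduct of frames, generated under joins by the rectangles $x\otimes y=\iota_1(x)\wedge\iota_2(y)$ ($\iota_1,\iota_2$ the coproduct injections); $\mathcal{O}(X\times Y)=\mathcal{O}X\otimes\mathcal{O}Y$. A sublocale of $X$ is (an isomorphism class of) an extremal monomorphism $A\rightarrowtail X$, equivalently a map whose frame map is surjective; $A\subseteq B$ means the inclusion of $A$ factors through that of $B$. Open cone relations. A localic relation on $X$ is a sublocale $r\colon R\rightarrowtail X\times X$; its source and target maps are $s=\mathrm{pr}_1\circ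 r$, $t=\mathrm{pr}_2\circ r\colon R\to X$. A locale map $f\colon X\to Y$ is open if $f^{-1}$ has a left adjoint $f_!$ with $f_!(U\wedge f^{-1}(V))=f_!(U)\wedge V$. $R$ has open cones if $s,t$ are open; then its induced cones are $\Uparrow_R:=t_!s^{-1}$ and $\Downarrow_R:=s_!t^{-1}\colon\mathcal{O}X\to\mathcal{O}X$. $\mathbf{rocLoc}$ has as objects pairs $(X,R)$ of a locale with a localic relation with open cones; morphisms $(X,r\colon R\rightarrowtail X\times X)\to(Y,q\colon Q\rightarrowtail Y\times Y)$ are the monotone maps: locale maps $f\colon X\to Y$ for which there is a locale map $\bar f\colon R\to Q$ with $q\circ\bar f=(f\times f)\circ r$. Conic frames. A conic frame $(L,\mathsf{u},\mathsf{d})$ is a frame $L$ with two join-preserving functions $\mathsf{u},\mathsf{d}\colon L\to L$ that are parallel: $\mathsf{u}(x)\wedge y\sqsubseteq\mathsf{u}(x\wedge\mathsf{d}(y))$ and $x\wedge\mathsf{d}(y)\sqsubseteq\mathsf{d}(\mathsf{u}(x)\wedge y)$ for all $x,y\in L$. A conic morphism $h\colon(L,\mathsf{u},\mathsf{d})\to(M,\mathsf{u}',\mathsf{d}')$ is a frame map $h\colon L\to M$ with $\mathsf{u}'\circ h\sqsubseteq h\circ\mathsf{u}$ and $\mathsf{d}'\circ h\sqsubseteq h\circ\mathsf{d}$ (pointwise). $\mathbf{ConFrm}$ is the category of conic frames and conic morphisms. Induced relation. For a conic frame $(\mathcal{O}X,\mathsf{u},\mathsf{d})$, let $\sim$ be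 the binary relation on rectangles of $\mathcal{O}X\otimes\mathcal{O}X$ with $a\otimes b\sim c\otimes d$ iff $\mathsf{u}(a)\wedge b=\mathsf{u}(c)\wedge d$ and $a\wedge\mathsf{d}(b)=c\wedge\mathsf{d}(d)$. An element $o\in\mathcal{O}X\otimes\mathcal{O}X$ is $\sim$-saturated if for all $p\sim q$ and all $w$: $p\wedge w\sqsubseteq o$ iff $q\wedge w\sqsubseteq o$. $R_{\mathsf{u},\mathsf{d}}\rightarrowtail X\times X$ is the sublocale whose frame is the set of $\sim$-saturated elements, with frame map $\mu_\sim(o)=$ the least $\sim$-saturated element above $o$; equivalently, the quotient of $\mathcal{O}X\otimes\mathcal{O}X$ by the frame congruence generated by $\sim$. *)

theory Defs
  imports "HOL-Algebra.Galois_Connection" "HOL-Library.FuncSet"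
begin

section \<open>Categories, functors and adjunctions\<close>

text \<open>Categories are given by hom-families; hom-sets of different pairs of objects need not be
  disjoint, so composition and functors take the objects involved as additional arguments.
  \<open>Comp C X Y Z g f\<close> is the composite of \<open>f : X \<rightarrow> Y\<close> and \<open>g : Y \<rightarrow> Z\<close>.\<close>

record ('o, 'm) category =
  Obj :: "'o set"
  Hom :: "'o \<Rightarrow> 'o \<Rightarrow> 'm set"
  Ident :: "'o \<Rightarrow> 'm"
  Comp :: "'o \<Rightarrow> 'o \<Rightarrow> 'o \<Rightarrow> 'm \<Rightarrow> 'm \<Rightarrow> 'm"

locale category =
  fixes C :: "('o, 'm) category"
  assumes Ident_in_Hom: "X \<in> Obj C \<Longrightarrow> Ident C X \<in> Hom C X X"
    and Comp_in_Hom: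
      "\<lbrakk>X \<in> Obj C; Y \<in> Obj C; Z \<in> Obj C; f \<in> Hom C X Y; g \<in> Hom C Y Z\<rbrakk>
        \<Longrightarrow> Comp C X Y Z g f \<in> Hom C X Z"
    and Comp_Ident_left:
      "\<lbrakk>X \<in> Obj C; Y \<in> Obj C; f \<in> Hom C X Y\<rbrakk> \<Longrightarrow> Comp C X Y Y (Ident C Y) f = f"
    and Comp_Ident_right:
      "\<lbrakk>X \<in> Obj C; Y \<in> Obj C; f \<in> Hom C X Y\<rbrakk> \<Longrightarrow> Comp C X X Y f (Ident C X) = f"
    and Comp_assoc:
      "\<lbrakk>W \<in> Obj C; X \<in> Obj C; Y \<in> Obj C; Z \<in> Obj C;
        f \<in> Hom C W X; g \<in> Hom C X Y; h \<in> Hom C Y Z\<rbrakk>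
        \<Longrightarrow> Comp C W X Z (Comp C X Y Z h g) f = Comp C W Y Z h (Comp C W X Y g f)"

definition op_cat :: "('o, 'm) category \<Rightarrow> ('o, 'm) category" where
  "op_cat C = \<lparr>Obj = Obj C, Hom = (\<lambda>X Y. Hom C Y X), Ident = Ident C,
     Comp = (\<lambda>X Y Z g f. Comp C Z Y X f g)\<rparr>"

record ('o, 'm, 'p, 'n) cat_fun =
  fobj :: "'o \<Rightarrow> 'p"
  fmap :: "'o \<Rightarrow> 'o \<Rightarrow> 'm \<Rightarrow> 'n"

locale cat_functor = C: category C + D: category D
  for C :: "('o, 'm) category" and D :: "('p, 'n) category"
    and F :: "('o, 'm, 'p, 'n) cat_fun" +
  assumes fobj_in_Obj: "X \<in> Obj C \<Longrightarrow> fobj F X \<in> Obj D"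
    and fmap_in_Hom:
      "\<lbrakk>X \<in> Obj C; Y \<in> Obj C; f \<in> Hom C X Y\<rbrakk>
        \<Longrightarrow> fmap F X Y f \<in> Hom D (fobj F X) (fobj F Y)"
    and fmap_Ident: "X \<in> Obj C \<Longrightarrow> fmap F X X (Ident C X) = Ident D (fobj F X)"
    and fmap_Comp:
      "\<lbrakk>X \<in> Obj C; Y \<in> Obj C; Z \<in> Obj C; f \<in> Hom C X Y; g \<in> Hom C Y Z\<rbrakk>
        \<Longrightarrow> fmap F X Z (Comp C X Y Z g f) =
            Comp D (fobj F X) (fobj F Y) (fobj F Z) (fmap F Y Z g) (fmap F X Y f)"

definition id_fun :: "('o, 'm, 'o, 'm) cat_fun" where
  "id_fun = \<lparr>fobj = (\<lambda>X. X), fmap = (\<lambda>X Y f. f)\<rparr>"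

definition comp_fun ::
  "('p, 'n, 'q, 'k) cat_fun \<Rightarrow> ('o, 'm, 'p, 'n) cat_fun \<Rightarrow> ('o, 'm, 'q, 'k) cat_fun" where
  "comp_fun G F = \<lparr>fobj = (\<lambda>X. fobj G (fobj F X)),
     fmap = (\<lambda>X Y f. fmap G (fobj F X) (fobj F Y) (fmap F X Y f))\<rparr>"

text \<open>Functors out of \<open>C\<close> are only determined on the objects and arrows of \<open>C\<close>.\<close>

definition functor_eq ::
  "('o, 'm) category \<Rightarrow> ('o, 'm, 'p, 'n) cat_fun \<Rightarrow> ('o, 'm, 'p, 'n) cat_fun \<Rightarrow> bool" where
  "functor_eq C F G \<longleftrightarrow>
     (\<forall>X\<in>Obj C. fobj F X = fobj G X) \<and>
     (\<forall>X\<in>Obj C. \<forall>Y\<in>Obj C. \<forall>f\<in>Hom C X Y. fmap F X Y f = fmap G X Y f)"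

locale nat_trans = F: cat_functor C D F + G: cat_functor C D G
  for C :: "('o, 'm) category" and D :: "('p, 'n) category"
    and F G :: "('o, 'm, 'p, 'n) cat_fun" and \<tau> :: "'o \<Rightarrow> 'n" +
  assumes component_in_Hom: "X \<in> Obj C \<Longrightarrow> \<tau> X \<in> Hom D (fobj F X) (fobj G X)"
    and naturality:
      "\<lbrakk>X \<in> Obj C; Y \<in> Obj C; f \<in> Hom C X Y\<rbrakk>
        \<Longrightarrow> Comp D (fobj F X) (fobj F Y) (fobj G Y) (\<tau> Y) (fmap F X Y f) =
            Comp D (fobj F X) (fobj G X) (fobj G Y) (fmap G X Y f) (\<tau> X)"

text \<open>\<open>F \<stileturn> G\<close> with unit \<open>\<eta> : 1 \<rightarrow> G F\<close> and counit \<open>\<epsilon> : F G \<rightarrow> 1\<close>.\<close>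

locale adjunction =
  F: cat_functor C D F + G: cat_functor D C G +
  unit: nat_trans C C id_fun "comp_fun G F" \<eta> +
  counit: nat_trans D D "comp_fun F G" id_fun \<epsilon>
  for C :: "('o, 'm) category" and D :: "('p, 'n) category"
    and F :: "('o, 'm, 'p, 'n) cat_fun" and G :: "('p, 'n, 'o, 'm) cat_fun"
    and \<eta> :: "'o \<Rightarrow> 'm" and \<epsilon> :: "'p \<Rightarrow> 'n" +
  assumes triangle_left:
      "X \<in> Obj C \<Longrightarrow>
        Comp D (fobj F X) (fobj F (fobj G (fobj F X))) (fobj F X)
          (\<epsilon> (fobj F X)) (fmap F X (fobj G (fobj F X)) (\<eta> X)) = Ident D (fobj F X)"
    and triangle_right:
      "Y \<in> Obj D \<Longrightarrow>
        Comp C (fobj G Y) (fobj G (fobj F (fobj G Y))) (fobj G Y)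
          (fmap G (fobj F (fobj G Y)) Y (\<epsilon> Y)) (\<eta> (fobj G Y)) = Ident C (fobj G Y)"


section \<open>Frames and locales\<close>

text \<open>A locale is represented by its frame of opens, and a locale map \<open>f : X \<rightarrow> Y\<close> by the frame map
  \<open>f\<inverse> : \<O>Y \<rightarrow> \<O>X\<close>. Maps are extensional functions on the carriers, so that equality of maps is
  equality of HOL functions.\<close>

locale frame = complete_lattice L for L (structure) +
  assumes meet_Sup_distrib:
    "\<lbrakk>x \<in> carrier L; A \<subseteq> carrier L\<rbrakk> \<Longrightarrow> x \<sqinter> (\<Squnion>A) = \<Squnion>((\<lambda>y. x \<sqinter> y) ` A)"

definition frame_hom :: "'a gorder \<Rightarrow> 'b gorder \<Rightarrow> ('a \<Rightarrow> 'b) set" where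
  "frame_hom L M = {h \<in> carrier L \<rightarrow>\<^sub>E carrier M.
     h \<top>\<^bsub>L\<^esub> = \<top>\<^bsub>M\<^esub> \<and> meet_pres L M h \<and> sup_pres L M h}"

text \<open>The coproduct \<open>L \<otimes> M\<close>, in its standard construction by coproduct ideals: down-sets of
  \<open>L \<times> M\<close> closed under joins in each coordinate (including the empty join).
  The universal property is proved in \<open>frame_tensor_coproduct\<close> below.\<close>

definition coprod_ideal :: "'a gorder \<Rightarrow> 'b gorder \<Rightarrow> ('a \<times> 'b) set \<Rightarrow> bool" where
  "coprod_ideal L M U \<longleftrightarrow>
     U \<subseteq> carrier L \<times> carrier M \<and>
     (\<forall>(x, y)\<in>U. \<forall>a\<in>carrier L. \<forall>b\<in>carrier M. a \<sqsubseteq>\<^bsub>L\<^esub> x \<and> b \<sqsubseteq>\<^bsub>M\<^esub> y \<longrightarrow> (a, b) \<in> U) \<and>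
     (\<forall>A\<subseteq>carrier L. \<forall>y\<in>carrier M. (\<forall>x\<in>A. (x, y) \<in> U) \<longrightarrow> (\<Squnion>\<^bsub>L\<^esub>A, y) \<in> U) \<and>
     (\<forall>x\<in>carrier L. \<forall>B\<subseteq>carrier M. (\<forall>y\<in>B. (x, y) \<in> U) \<longrightarrow> (x, \<Squnion>\<^bsub>M\<^esub>B) \<in> U)"

definition frame_tensor :: "'a gorder \<Rightarrow> 'b gorder \<Rightarrow> ('a \<times> 'b) set gorder" where
  "frame_tensor L M = \<lparr>carrier = {U. coprod_ideal L M U}, eq = (=), le = (\<subseteq>)\<rparr>"

definition coprod_inj1 :: "'a gorder \<Rightarrow> 'b gorder \<Rightarrow> 'a \<Rightarrow> ('a \<times> 'b) set" where
  "coprod_inj1 L M = (\<lambda>x\<in>carrier L.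
     {(a, b). a \<in> carrier L \<and> b \<in> carrier M \<and> (a \<sqsubseteq>\<^bsub>L\<^esub> x \<or> b = \<bottom>\<^bsub>M\<^esub>)})"

definition coprod_inj2 :: "'a gorder \<Rightarrow> 'b gorder \<Rightarrow> 'b \<Rightarrow> ('a \<times> 'b) set" where
  "coprod_inj2 L M = (\<lambda>y\<in>carrier M.
     {(a, b). a \<in> carrier L \<and> b \<in> carrier M \<and> (a = \<bottom>\<^bsub>L\<^esub> \<or> b \<sqsubseteq>\<^bsub>M\<^esub> y)})"

definition rectangle :: "'a gorder \<Rightarrow> 'b gorder \<Rightarrow> 'a \<Rightarrow> 'b \<Rightarrow> ('a \<times> 'b) set" where
  "rectangle L M x y = coprod_inj1 L M x \<sqinter>\<^bsub>frame_tensor L M\<^esub> coprod_inj2 L M y"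

definition copair ::
  "'a gorder \<Rightarrow> 'b gorder \<Rightarrow> 'c gorder \<Rightarrow> ('a \<Rightarrow> 'c) \<Rightarrow> ('b \<Rightarrow> 'c) \<Rightarrow> ('a \<times> 'b) set \<Rightarrow> 'c" where
  "copair L M N f g =
     (\<lambda>U\<in>carrier (frame_tensor L M). \<Squnion>\<^bsub>N\<^esub>((\<lambda>(a, b). f a \<sqinter>\<^bsub>N\<^esub> g b) ` U))"

text \<open>The frame map of \<open>f \<times> f : X \<times> X \<rightarrow> Y \<times> Y\<close>, where \<open>h\<close> is the frame map of \<open>f\<close>.\<close>

definition square_map :: "'a gorder \<Rightarrow> 'b gorder \<Rightarrow> ('b \<Rightarrow> 'a) \<Rightarrow> ('b \<times> 'b) set \<Rightarrow> ('a \<times> 'a) set" where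
  "square_map X Y h = copair Y Y (frame_tensor X X)
     (compose (carrier Y) (coprod_inj1 X X) h) (compose (carrier Y) (coprod_inj2 X X) h)"


subsection \<open>The universal property of \<open>L \<otimes> M\<close>\<close>

lemma frame_homD:
  assumes "h \<in> frame_hom L M"
  shows "h \<in> carrier L \<rightarrow>\<^sub>E carrier M"
    and "h \<top>\<^bsub>L\<^esub> = \<top>\<^bsub>M\<^esub>"
    and "\<And>x y. \<lbrakk>x \<in> carrier L; y \<in> carrier L\<rbrakk> \<Longrightarrow> h (x \<sqinter>\<^bsub>L\<^esub> y) = h x \<sqinter>\<^bsub>M\<^esub> h y"
    and "\<And>A. A \<subseteq> carrier L \<Longrightarrow> h (\<Squnion>\<^bsub>L\<^esub>A) = \<Squnion>\<^bsub>M\<^esub>(h ` A)"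
    and "\<And>x y. \<lbrakk>x \<in> carrier L; y \<in> carrier L; x \<sqsubseteq>\<^bsub>L\<^esub> y\<rbrakk> \<Longrightarrow> h x \<sqsubseteq>\<^bsub>M\<^esub> h y"
proof -
  show h: "h \<in> carrier L \<rightarrow>\<^sub>E carrier M" and "h \<top>\<^bsub>L\<^esub> = \<top>\<^bsub>M\<^esub>"
    and "\<And>x y. \<lbrakk>x \<in> carrier L; y \<in> carrier L\<rbrakk> \<Longrightarrow> h (x \<sqinter>\<^bsub>L\<^esub> y) = h x \<sqinter>\<^bsub>M\<^esub> h y"
    and "\<And>A. A \<subseteq> carrier L \<Longrightarrow> h (\<Squnion>\<^bsub>L\<^esub>A) = \<Squnion>\<^bsub>M\<^esub>(h ` A)"
    using assms by (auto simp: frame_hom_def meet_pres_def sup_pres_def)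
  have "isotone L M h"
    using h assms by (intro meet_pres_isotone) (auto simp: frame_hom_def)
  then show "\<And>x y. \<lbrakk>x \<in> carrier L; y \<in> carrier L; x \<sqsubseteq>\<^bsub>L\<^esub> y\<rbrakk> \<Longrightarrow> h x \<sqsubseteq>\<^bsub>M\<^esub> h y"
    by (simp add: isotone_def)
qed

lemma frame_homI:
  assumes "frame L" "frame M" "h \<in> carrier L \<rightarrow>\<^sub>E carrier M" "h \<top>\<^bsub>L\<^esub> = \<top>\<^bsub>M\<^esub>"
    and "\<And>x y. \<lbrakk>x \<in> carrier L; y \<in> carrier L\<rbrakk> \<Longrightarrow> h (x \<sqinter>\<^bsub>L\<^esub> y) = h x \<sqinter>\<^bsub>M\<^esub> h y"
    and "\<And>A. A \<subseteq> carrier L \<Longrightarrow> h (\<Squnion>\<^bsub>L\<^esub>A) = \<Squnion>\<^bsub>M\<^esub>(h ` A)"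
  shows "h \<in> frame_hom L M"
  using assms by (auto simp: frame_hom_def meet_pres_def sup_pres_def frame_def)

context frame
begin

lemma le_sup_iff: "A \<subseteq> carrier L \<Longrightarrow> x \<in> carrier L \<Longrightarrow> \<Squnion>A \<sqsubseteq> x \<longleftrightarrow> (\<forall>a\<in>A. a \<sqsubseteq> x)"
  by (meson le_trans subsetD sup_closed sup_least sup_upper)

lemma le_meet_iff:
  "\<lbrakk>x \<in> carrier L; y \<in> carrier L; z \<in> carrier L\<rbrakk> \<Longrightarrow> z \<sqsubseteq> x \<sqinter> y \<longleftrightarrow> z \<sqsubseteq> x \<and> z \<sqsubseteq> y"
  by (meson le_trans meet_closed meet_le meet_left meet_right)

lemma sup_eqI:
  assumes "A \<subseteq> carrier L" "x \<in> carrier L" "\<And>a. a \<in> A \<Longrightarrow> a \<sqsubseteq> x"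
    "\<And>y. y \<in> carrier L \<Longrightarrow> (\<And>a. a \<in> A \<Longrightarrow> a \<sqsubseteq> y) \<Longrightarrow> x \<sqsubseteq> y"
  shows "\<Squnion>A = x"
  using assms(1-3) assms(4)[of "\<Squnion>A"]
  by (intro le_antisym) (auto intro: sup_least sup_upper)

lemma meet_eqI:
  assumes "x \<in> carrier L" "y \<in> carrier L" "z \<in> carrier L" "z \<sqsubseteq> x" "z \<sqsubseteq> y"
    "\<And>w. \<lbrakk>w \<in> carrier L; w \<sqsubseteq> x; w \<sqsubseteq> y\<rbrakk> \<Longrightarrow> w \<sqsubseteq> z"
  shows "x \<sqinter> y = z"
  using assms(1-5) assms(6)[of "x \<sqinter> y"]
  by (intro le_antisym) (auto intro: meet_le meet_left meet_right)

lemma meet_le1: "\<lbrakk>x \<sqsubseteq> z; x \<in> carrier L; y \<in> carrier L; z \<in> carrier L\<rbrakk> \<Longrightarrow> x \<sqinter> y \<sqsubseteq> z"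
  by (rule le_trans[OF meet_left]) auto

lemma meet_le2: "\<lbrakk>y \<sqsubseteq> z; x \<in> carrier L; y \<in> carrier L; z \<in> carrier L\<rbrakk> \<Longrightarrow> x \<sqinter> y \<sqsubseteq> z"
  by (rule le_trans[OF meet_right]) auto

lemma meet_mono:
  "\<lbrakk>x \<in> carrier L; y \<in> carrier L; x' \<in> carrier L; y' \<in> carrier L; x \<sqsubseteq> x'; y \<sqsubseteq> y'\<rbrakk>
    \<Longrightarrow> x \<sqinter> y \<sqsubseteq> x' \<sqinter> y'"
  by (rule meet_le) (auto intro: meet_le1 meet_le2)

lemma sup_empty_eq: "\<Squnion>{} = \<bottom>"
  by (rule sup_eqI) auto

lemma meet_Sup_le:
  assumes "x \<in> carrier L" "A \<subseteq> carrier L" "z \<in> carrier L" "\<And>a. a \<in> A \<Longrightarrow> x \<sqinter> a \<sqsubseteq> z"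
  shows "x \<sqinter> \<Squnion>A \<sqsubseteq> z"
  using assms by (subst meet_Sup_distrib) (auto intro!: sup_least)

end

lemma frame_complete: "frame L \<Longrightarrow> complete_lattice L"
  by (simp add: frame_def)

locale frame_pair = L: frame L + M: frame M for L :: "'a gorder" and M :: "'b gorder"
begin

abbreviation "T \<equiv> frame_tensor L M"

lemma carrier_T [simp]: "carrier T = {U. coprod_ideal L M U}"
  and le_T [simp]: "le T = (\<subseteq>)" and eq_T [simp]: "eq T = (=)"
  by (simp_all add: frame_tensor_def)

lemma ideal_sub: "coprod_ideal L M U \<Longrightarrow> U \<subseteq> carrier L \<times> carrier M"
  by (simp add: coprod_ideal_def)

lemma ideal_down:
  "\<lbrakk>coprod_ideal L M U; (x, y) \<in> U; a \<in> carrier L; b \<in> carrier M; a \<sqsubseteq>\<^bsub>L\<^esub> x; b \<sqsubseteq>\<^bsub>M\<^esub> y\<rbrakk> \<Longrightarrow> (a, b) \<in> U"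
  unfolding coprod_ideal_def by (drule conjunct2, drule conjunct1, drule (1) bspec) simp

lemma ideal_sup1:
  "\<lbrakk>coprod_ideal L M U; A \<subseteq> carrier L; y \<in> carrier M; \<And>x. x \<in> A \<Longrightarrow> (x, y) \<in> U\<rbrakk> \<Longrightarrow> (\<Squnion>\<^bsub>L\<^esub>A, y) \<in> U"
  unfolding coprod_ideal_def by simp

lemma ideal_sup2:
  "\<lbrakk>coprod_ideal L M U; x \<in> carrier L; B \<subseteq> carrier M; \<And>y. y \<in> B \<Longrightarrow> (x, y) \<in> U\<rbrakk> \<Longrightarrow> (x, \<Squnion>\<^bsub>M\<^esub>B) \<in> U"
  unfolding coprod_ideal_def by simp

lemma idealI:
  assumes "U \<subseteq> carrier L \<times> carrier M"
    "\<And>x y a b. \<lbrakk>(x, y) \<in> U; a \<in> carrier L; b \<in> carrier M; x \<in> carrier L; y \<in> carrier M; a \<sqsubseteq>\<^bsub>L\<^esub> x; b \<sqsubseteq>\<^bsub>M\<^esub> y\<rbrakk> \<Longrightarrow> (a, b) \<in> U"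
    "\<And>A y. \<lbrakk>A \<subseteq> carrier L; y \<in> carrier M; \<And>x. x \<in> A \<Longrightarrow> (x, y) \<in> U\<rbrakk> \<Longrightarrow> (\<Squnion>\<^bsub>L\<^esub>A, y) \<in> U"
    "\<And>x B. \<lbrakk>x \<in> carrier L; B \<subseteq> carrier M; \<And>y. y \<in> B \<Longrightarrow> (x, y) \<in> U\<rbrakk> \<Longrightarrow> (x, \<Squnion>\<^bsub>M\<^esub>B) \<in> U"
  shows "coprod_ideal L M U"
  unfolding coprod_ideal_def using assms by (auto 0 3)

lemma ideal_bot:
  assumes "coprod_ideal L M U" "x \<in> carrier L" "y \<in> carrier M"
  shows "(\<bottom>\<^bsub>L\<^esub>, y) \<in> U" "(x, \<bottom>\<^bsub>M\<^esub>) \<in> U"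
  using ideal_sup1[OF assms(1), of "{}" y] ideal_sup2[OF assms(1), of x "{}"] assms
  by (auto simp: L.sup_empty_eq M.sup_empty_eq)

lemma ideal_Inter:
  assumes "\<And>U. U \<in> \<U> \<Longrightarrow> coprod_ideal L M U"
  shows "coprod_ideal L M (carrier L \<times> carrier M \<inter> \<Inter>\<U>)"
proof (rule idealI, goal_cases)
  case 1 then show ?case by blast
next
  case (2 x y a b) then show ?case using assms ideal_down by blast
next
  case (3 A y) then show ?case using assms ideal_sup1[of _ A y] by auto
next
  case (4 x B) then show ?case using assms ideal_sup2[of _ x B] by auto
qed

lemma ideal_Int: "coprod_ideal L M U \<Longrightarrow> coprod_ideal L M V \<Longrightarrow> coprod_ideal L M (U \<inter> V)"
  using ideal_Inter[of "{U, V}"] ideal_sub[of U] by (auto simp: Int_absorb1 Int_assoc[symmetric])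

lemma ideal_full: "coprod_ideal L M (carrier L \<times> carrier M)"
  using ideal_Inter[of "{}"] by simp

lemma complete_T: "complete_lattice T"
proof -
  interpret T: partial_order T
    by unfold_locales auto
  show ?thesis
  proof (rule T.complete_latticeI)
    fix \<U> assume U: "\<U> \<subseteq> carrier T"
    have "coprod_ideal L M (carrier L \<times> carrier M \<inter> \<Inter>(Upper T \<U>))"
      by (rule ideal_Inter) (auto simp: Upper_def)
    moreover have "U \<subseteq> carrier L \<times> carrier M \<inter> \<Inter>(Upper T \<U>)" if "U \<in> \<U>" for U
      using that U ideal_sub[of U] by (auto simp: Upper_def)
    ultimately show "\<exists>s. least T s (Upper T \<U>)"
      by (intro exI[of _ "carrier L \<times> carrier M \<inter> \<Inter>(Upper T \<U>)"]) (auto simp: least_def Upper_def)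
    have "coprod_ideal L M (carrier L \<times> carrier M \<inter> \<Inter>\<U>)"
      by (rule ideal_Inter) (use U in auto)
    then show "\<exists>i. greatest T i (Lower T \<U>)"
      using U by (intro exI[of _ "carrier L \<times> carrier M \<inter> \<Inter>\<U>"])
        (auto simp: greatest_def Lower_def dest: ideal_sub)
  qed
qed

sublocale T: complete_lattice T by (rule complete_T)

lemma meet_T: "\<lbrakk>coprod_ideal L M U; coprod_ideal L M V\<rbrakk> \<Longrightarrow> U \<sqinter>\<^bsub>T\<^esub> V = U \<inter> V"
  using T.meet_left[of U V] T.meet_right[of U V] T.meet_le[of "U \<inter> V" U V] ideal_Int[of U V]
  by auto

lemma sup_T_least: "\<lbrakk>\<U> \<subseteq> Collect (coprod_ideal L M); coprod_ideal L M V; \<And>U. U \<in> \<U> \<Longrightarrow> U \<subseteq> V\<rbrakk>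
    \<Longrightarrow> \<Squnion>\<^bsub>T\<^esub>\<U> \<subseteq> V"
  using T.sup_least[of \<U> V] by auto

lemma sup_T_upper: "\<lbrakk>\<U> \<subseteq> Collect (coprod_ideal L M); U \<in> \<U>\<rbrakk> \<Longrightarrow> U \<subseteq> \<Squnion>\<^bsub>T\<^esub>\<U>"
  using T.sup_upper[of \<U> U] by auto

lemma sup_T_ideal: "\<U> \<subseteq> Collect (coprod_ideal L M) \<Longrightarrow> coprod_ideal L M (\<Squnion>\<^bsub>T\<^esub>\<U>)"
  using T.sup_closed[of \<U>] by auto

lemma top_T: "\<top>\<^bsub>T\<^esub> = carrier L \<times> carrier M"
  using T.top_higher[of "carrier L \<times> carrier M"] T.top_closed ideal_full ideal_sub by auto

lemma ideal_imp:
  assumes U: "coprod_ideal L M U" and W: "coprod_ideal L M W"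
  shows "coprod_ideal L M {(a, b). a \<in> carrier L \<and> b \<in> carrier M \<and>
    (\<forall>(c, e)\<in>U. (c \<sqinter>\<^bsub>L\<^esub> a, e \<sqinter>\<^bsub>M\<^esub> b) \<in> W)}" (is "coprod_ideal L M ?P")
proof (rule idealI, goal_cases)
  case 1 then show ?case by blast
next
  case (2 x y a b)
  have "(c \<sqinter>\<^bsub>L\<^esub> a, e \<sqinter>\<^bsub>M\<^esub> b) \<in> W" if "(c, e) \<in> U" for c e
  proof -
    have "c \<in> carrier L" "e \<in> carrier M" using that ideal_sub[OF U] by auto
    moreover have "(c \<sqinter>\<^bsub>L\<^esub> x, e \<sqinter>\<^bsub>M\<^esub> y) \<in> W" using 2(1) that by blast
    ultimately show ?thesis
      using 2(2-7) by (elim ideal_down[OF W]) (auto intro!: L.meet_mono M.meet_mono)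
  qed
  then show ?case using 2(2,3) by blast
next
  case (3 A y)
  have "(c \<sqinter>\<^bsub>L\<^esub> \<Squnion>\<^bsub>L\<^esub>A, e \<sqinter>\<^bsub>M\<^esub> y) \<in> W" if "(c, e) \<in> U" for c e
  proof -
    have "c \<in> carrier L" "e \<in> carrier M" using that ideal_sub[OF U] by auto
    moreover have "(c \<sqinter>\<^bsub>L\<^esub> x, e \<sqinter>\<^bsub>M\<^esub> y) \<in> W" if "x \<in> A" for x
      using 3(3)[OF that] \<open>(c, e) \<in> U\<close> by blast
    moreover have "(\<Squnion>\<^bsub>L\<^esub>((\<lambda>x. c \<sqinter>\<^bsub>L\<^esub> x) ` A), e \<sqinter>\<^bsub>M\<^esub> y) \<in> W"
      by (rule ideal_sup1[OF W]) (use 3(1,2) calculation in auto)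
    ultimately show ?thesis
      using 3(1) by (simp add: L.meet_Sup_distrib)
  qed
  then show ?case using 3(1,2) by auto
next
  case (4 x B)
  have "(c \<sqinter>\<^bsub>L\<^esub> x, e \<sqinter>\<^bsub>M\<^esub> \<Squnion>\<^bsub>M\<^esub>B) \<in> W" if "(c, e) \<in> U" for c e
  proof -
    have "c \<in> carrier L" "e \<in> carrier M" using that ideal_sub[OF U] by auto
    moreover have "(c \<sqinter>\<^bsub>L\<^esub> x, e \<sqinter>\<^bsub>M\<^esub> y) \<in> W" if "y \<in> B" for y
      using 4(3)[OF that] \<open>(c, e) \<in> U\<close> by blast
    moreover have "(c \<sqinter>\<^bsub>L\<^esub> x, \<Squnion>\<^bsub>M\<^esub>((\<lambda>y. e \<sqinter>\<^bsub>M\<^esub> y) ` B)) \<in> W"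
      by (rule ideal_sup2[OF W]) (use 4(1,2) calculation in auto)
    ultimately show ?thesis
      using 4(2) by (simp add: M.meet_Sup_distrib)
  qed
  then show ?case using 4(1,2) by auto
qed

lemma frame_T: "frame T"
proof (unfold_locales, goal_cases)
  case (1 U \<U>)
  then have U: "coprod_ideal L M U" and UU: "\<U> \<subseteq> Collect (coprod_ideal L M)" by auto
  define W where "W = \<Squnion>\<^bsub>T\<^esub>((\<lambda>V. U \<sqinter>\<^bsub>T\<^esub> V) ` \<U>)"
  have img: "(\<lambda>V. U \<sqinter>\<^bsub>T\<^esub> V) ` \<U> \<subseteq> Collect (coprod_ideal L M)"
    using U UU by (auto simp: meet_T ideal_Int subset_eq)
  have W: "coprod_ideal L M W" unfolding W_def by (rule sup_T_ideal[OF img])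
  have UV: "U \<inter> V \<subseteq> W" if "V \<in> \<U>" for V
    using sup_T_upper[OF img, of "U \<sqinter>\<^bsub>T\<^esub> V"] that U UU by (auto simp: W_def meet_T subset_eq)
  let ?P = "{(a, b). a \<in> carrier L \<and> b \<in> carrier M \<and> (\<forall>(c, e)\<in>U. (c \<sqinter>\<^bsub>L\<^esub> a, e \<sqinter>\<^bsub>M\<^esub> b) \<in> W)}"
  have "V \<subseteq> ?P" if V: "V \<in> \<U>" for V
  proof safe
    have iV: "coprod_ideal L M V" using V UU by auto
    fix a b assume ab: "(a, b) \<in> V"
    then show abc: "a \<in> carrier L" "b \<in> carrier M" using ideal_sub[OF iV] by auto
    fix c e assume ce: "(c, e) \<in> U"
    then have "c \<in> carrier L" "e \<in> carrier M" using ideal_sub[OF U] by auto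
    then have "(c \<sqinter>\<^bsub>L\<^esub> a, e \<sqinter>\<^bsub>M\<^esub> b) \<in> U \<inter> V"
      using abc by (auto intro: ideal_down[OF U ce] ideal_down[OF iV ab] L.meet_left L.meet_right M.meet_left M.meet_right)
    then show "(c \<sqinter>\<^bsub>L\<^esub> a, e \<sqinter>\<^bsub>M\<^esub> b) \<in> W" using UV[OF V] by auto
  qed
  then have S: "\<Squnion>\<^bsub>T\<^esub>\<U> \<subseteq> ?P" by (intro sup_T_least[OF UU] ideal_imp U W)
  have "U \<inter> \<Squnion>\<^bsub>T\<^esub>\<U> \<subseteq> W"
  proof (clarify)
    fix a b assume ab: "(a, b) \<in> U" "(a, b) \<in> \<Squnion>\<^bsub>T\<^esub>\<U>"
    then have "(a \<sqinter>\<^bsub>L\<^esub> a, b \<sqinter>\<^bsub>M\<^esub> b) \<in> W" using S by auto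
    moreover have "a \<in> carrier L" "b \<in> carrier M" using ab ideal_sub[OF U] by auto
    ultimately show "(a, b) \<in> W" 
      using L.meet_eqI[of a a a] M.meet_eqI[of b b b] by simp
  qed
  moreover have "W \<subseteq> U \<inter> \<Squnion>\<^bsub>T\<^esub>\<U>"
    unfolding W_def using U UU sup_T_ideal[OF UU] sup_T_upper[OF UU] img
    by (intro sup_T_least ideal_Int) (auto simp: meet_T subset_eq)
  ultimately have "U \<inter> \<Squnion>\<^bsub>T\<^esub>\<U> = W" by (rule equalityI)
  then show ?case
    using meet_T[OF U sup_T_ideal[OF UU]] by (simp only: W_def)
qed

lemma ideal_inj1: "x \<in> carrier L \<Longrightarrow> coprod_ideal L M (coprod_inj1 L M x)"
proof (rule idealI, goal_cases)
  case 2 then show ?case unfolding coprod_inj1_def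
    by (auto intro: L.le_trans simp: M.le_antisym)
next
  case (3 A y) then show ?case unfolding coprod_inj1_def
    by (cases "y = \<bottom>\<^bsub>M\<^esub>") (auto simp: L.le_sup_iff)
next
  case (4 a B)
  then show ?case unfolding coprod_inj1_def
    by (cases "a \<sqsubseteq>\<^bsub>L\<^esub> x") (auto intro!: M.sup_eqI)
qed (auto simp: coprod_inj1_def)

lemma ideal_inj2: "y \<in> carrier M \<Longrightarrow> coprod_ideal L M (coprod_inj2 L M y)"
proof (rule idealI, goal_cases)
  case 2 then show ?case unfolding coprod_inj2_def
    by (auto intro: M.le_trans simp: L.le_antisym)
next
  case (3 A b) then show ?case unfolding coprod_inj2_def
    by (cases "b \<sqsubseteq>\<^bsub>M\<^esub> y") (auto intro!: L.sup_eqI)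
next
  case (4 a B)
  then show ?case unfolding coprod_inj2_def
    by (cases "a = \<bottom>\<^bsub>L\<^esub>") (auto simp: M.le_sup_iff)
qed (auto simp: coprod_inj2_def)

lemma inj1_hom: "coprod_inj1 L M \<in> frame_hom L T"
proof (rule frame_homI[OF L.frame_axioms frame_T], goal_cases)
  case 1
  have "coprod_inj1 L M \<in> extensional (carrier L)" by (simp add: coprod_inj1_def)
  then show ?case by (simp add: PiE_iff ideal_inj1)
next
  case 2 then show ?case by (auto simp: top_T coprod_inj1_def)
next
  case (3 x y) then show ?case
    by (subst meet_T) (auto simp: ideal_inj1, auto simp: coprod_inj1_def L.le_meet_iff)
next
  case (4 A)
  have img: "coprod_inj1 L M ` A \<subseteq> Collect (coprod_ideal L M)" using 4 ideal_inj1 by auto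
  have S: "coprod_ideal L M (\<Squnion>\<^bsub>T\<^esub>(coprod_inj1 L M ` A))" by (rule sup_T_ideal[OF img])
  have "(a, b) \<in> \<Squnion>\<^bsub>T\<^esub>(coprod_inj1 L M ` A)" if "(a, b) \<in> coprod_inj1 L M (\<Squnion>\<^bsub>L\<^esub>A)" for a b
  proof -
    have ab: "a \<in> carrier L" "b \<in> carrier M" and c: "a \<sqsubseteq>\<^bsub>L\<^esub> \<Squnion>\<^bsub>L\<^esub>A \<or> b = \<bottom>\<^bsub>M\<^esub>"
      using that 4 by (auto simp: coprod_inj1_def)
    have "(x, b) \<in> \<Squnion>\<^bsub>T\<^esub>(coprod_inj1 L M ` A)" if "x \<in> A" for x
    proof -
      have "(x, b) \<in> coprod_inj1 L M x" using that 4 ab by (auto simp: coprod_inj1_def)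
      then show ?thesis using sup_T_upper[OF img, of "coprod_inj1 L M x"] that by blast
    qed
    then have "(\<Squnion>\<^bsub>L\<^esub>A, b) \<in> \<Squnion>\<^bsub>T\<^esub>(coprod_inj1 L M ` A)"
      using ideal_sup1[OF S] 4 ab by auto
    then show ?thesis
      using c ab ideal_bot[OF S ab] ideal_down[OF S, of "\<Squnion>\<^bsub>L\<^esub>A" b a b] by auto
  qed
  moreover have "\<Squnion>\<^bsub>T\<^esub>(coprod_inj1 L M ` A) \<subseteq> coprod_inj1 L M (\<Squnion>\<^bsub>L\<^esub>A)"
  proof (rule sup_T_least[OF img ideal_inj1])
    fix U assume "U \<in> coprod_inj1 L M ` A"
    then obtain x where x: "x \<in> A" "U = coprod_inj1 L M x" by auto
    with 4 have "x \<sqsubseteq>\<^bsub>L\<^esub> \<Squnion>\<^bsub>L\<^esub>A" "x \<in> carrier L" by (auto intro: L.sup_upper)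
    then show "U \<subseteq> coprod_inj1 L M (\<Squnion>\<^bsub>L\<^esub>A)"
      using 4 x by (auto simp: coprod_inj1_def intro: L.le_trans)
  qed (use 4 in auto)
  ultimately show ?case by auto
qed

lemma inj2_hom: "coprod_inj2 L M \<in> frame_hom M T"
proof (rule frame_homI[OF M.frame_axioms frame_T], goal_cases)
  case 1
  have "coprod_inj2 L M \<in> extensional (carrier M)" by (simp add: coprod_inj2_def)
  then show ?case by (simp add: PiE_iff ideal_inj2)
next
  case 2 then show ?case by (auto simp: top_T coprod_inj2_def)
next
  case (3 x y) then show ?case
    by (subst meet_T) (auto simp: ideal_inj2, auto simp: coprod_inj2_def M.le_meet_iff)
next
  case (4 B)
  have img: "coprod_inj2 L M ` B \<subseteq> Collect (coprod_ideal L M)" using 4 ideal_inj2 by auto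
  have S: "coprod_ideal L M (\<Squnion>\<^bsub>T\<^esub>(coprod_inj2 L M ` B))" by (rule sup_T_ideal[OF img])
  have "(a, b) \<in> \<Squnion>\<^bsub>T\<^esub>(coprod_inj2 L M ` B)" if "(a, b) \<in> coprod_inj2 L M (\<Squnion>\<^bsub>M\<^esub>B)" for a b
  proof -
    have ab: "a \<in> carrier L" "b \<in> carrier M" and c: "b \<sqsubseteq>\<^bsub>M\<^esub> \<Squnion>\<^bsub>M\<^esub>B \<or> a = \<bottom>\<^bsub>L\<^esub>"
      using that 4 by (auto simp: coprod_inj2_def)
    have "(a, y) \<in> \<Squnion>\<^bsub>T\<^esub>(coprod_inj2 L M ` B)" if "y \<in> B" for y
    proof -
      have "(a, y) \<in> coprod_inj2 L M y" using that 4 ab by (auto simp: coprod_inj2_def)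
      then show ?thesis using sup_T_upper[OF img, of "coprod_inj2 L M y"] that by blast
    qed
    then have "(a, \<Squnion>\<^bsub>M\<^esub>B) \<in> \<Squnion>\<^bsub>T\<^esub>(coprod_inj2 L M ` B)"
      using ideal_sup2[OF S] 4 ab by auto
    then show ?thesis
      using c ab ideal_bot[OF S ab] ideal_down[OF S, of a "\<Squnion>\<^bsub>M\<^esub>B" a b] by auto
  qed
  moreover have "\<Squnion>\<^bsub>T\<^esub>(coprod_inj2 L M ` B) \<subseteq> coprod_inj2 L M (\<Squnion>\<^bsub>M\<^esub>B)"
  proof (rule sup_T_least[OF img ideal_inj2])
    fix U assume "U \<in> coprod_inj2 L M ` B"
    then obtain x where x: "x \<in> B" "U = coprod_inj2 L M x" by auto
    with 4 have "x \<sqsubseteq>\<^bsub>M\<^esub> \<Squnion>\<^bsub>M\<^esub>B" "x \<in> carrier M" by (auto intro: M.sup_upper)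
    then show "U \<subseteq> coprod_inj2 L M (\<Squnion>\<^bsub>M\<^esub>B)"
      using 4 x by (auto simp: coprod_inj2_def intro: M.le_trans)
  qed (use 4 in auto)
  ultimately show ?case by auto
qed

lemma rectangle_eq:
  "\<lbrakk>x \<in> carrier L; y \<in> carrier M\<rbrakk> \<Longrightarrow>
    rectangle L M x y = {(a, b). a \<in> carrier L \<and> b \<in> carrier M \<and>
      (a \<sqsubseteq>\<^bsub>L\<^esub> x \<and> b \<sqsubseteq>\<^bsub>M\<^esub> y \<or> a = \<bottom>\<^bsub>L\<^esub> \<or> b = \<bottom>\<^bsub>M\<^esub>)}"
  unfolding rectangle_def
  by (subst meet_T) (auto simp: ideal_inj1 ideal_inj2, auto simp: coprod_inj1_def coprod_inj2_def)

lemma ideal_rectangle: "\<lbrakk>x \<in> carrier L; y \<in> carrier M\<rbrakk> \<Longrightarrow> coprod_ideal L M (rectangle L M x y)"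
  unfolding rectangle_def by (simp add: meet_T ideal_inj1 ideal_inj2 ideal_Int)

lemma rectangle_subset_iff:
  assumes U: "coprod_ideal L M U" and "x \<in> carrier L" "y \<in> carrier M"
  shows "rectangle L M x y \<subseteq> U \<longleftrightarrow> (x, y) \<in> U"
  using assms ideal_bot[OF U] ideal_down[OF U, of x y] by (auto simp: rectangle_eq)

lemma Sup_rectangles:
  assumes U: "coprod_ideal L M U"
  shows "\<Squnion>\<^bsub>T\<^esub>((\<lambda>(a, b). rectangle L M a b) ` U) = U"
proof -
  have img: "(\<lambda>(a, b). rectangle L M a b) ` U \<subseteq> Collect (coprod_ideal L M)"
    using ideal_rectangle ideal_sub[OF U] by auto
  have "\<Squnion>\<^bsub>T\<^esub>((\<lambda>(a, b). rectangle L M a b) ` U) \<subseteq> U"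
  proof (rule sup_T_least[OF img U])
    fix V assume "V \<in> (\<lambda>(a, b). rectangle L M a b) ` U"
    then obtain a b where "(a, b) \<in> U" "V = rectangle L M a b" by auto
    then show "V \<subseteq> U" using ideal_sub[OF U] rectangle_subset_iff[OF U, of a b] by auto
  qed
  moreover have "(a, b) \<in> \<Squnion>\<^bsub>T\<^esub>((\<lambda>(a, b). rectangle L M a b) ` U)" if "(a, b) \<in> U" for a b
  proof -
    have "rectangle L M a b \<subseteq> \<Squnion>\<^bsub>T\<^esub>((\<lambda>(a, b). rectangle L M a b) ` U)"
      using that by (intro sup_T_upper[OF img]) auto
    then show ?thesis
      using that ideal_sub[OF U] rectangle_subset_iff[OF sup_T_ideal[OF img], of a b] by auto
  qed
  ultimately show ?thesis by auto
qed

end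

locale frame_cocone = frame_pair L M + N: frame N
  for L :: "'a gorder" and M :: "'b gorder" and N :: "'c gorder" +
  fixes f g
  assumes f: "f \<in> frame_hom L N" and g: "g \<in> frame_hom M N"
begin

abbreviation "k \<equiv> copair L M N f g"

lemma f_closed [simp]: "x \<in> carrier L \<Longrightarrow> f x \<in> carrier N"
  using frame_homD(1)[OF f] by auto

lemma g_closed [simp]: "x \<in> carrier M \<Longrightarrow> g x \<in> carrier N"
  using frame_homD(1)[OF g] by auto

lemma f_bot: "f \<bottom>\<^bsub>L\<^esub> = \<bottom>\<^bsub>N\<^esub>"
  using frame_homD(4)[OF f, of "{}"] by (simp add: L.sup_empty_eq N.sup_empty_eq)

lemma g_bot: "g \<bottom>\<^bsub>M\<^esub> = \<bottom>\<^bsub>N\<^esub>"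
  using frame_homD(4)[OF g, of "{}"] by (simp add: M.sup_empty_eq N.sup_empty_eq)

lemma image_closed:
  "coprod_ideal L M U \<Longrightarrow> (\<lambda>(a, b). f a \<sqinter>\<^bsub>N\<^esub> g b) ` U \<subseteq> carrier N"
  using ideal_sub[of U] by auto

lemma k_eq: "coprod_ideal L M U \<Longrightarrow> k U = \<Squnion>\<^bsub>N\<^esub>((\<lambda>(a, b). f a \<sqinter>\<^bsub>N\<^esub> g b) ` U)"
  by (simp add: copair_def)

lemma k_closed [simp]: "coprod_ideal L M U \<Longrightarrow> k U \<in> carrier N"
  by (simp add: k_eq image_closed)

lemma k_le_iff:
  "\<lbrakk>coprod_ideal L M U; n \<in> carrier N\<rbrakk> \<Longrightarrow> k U \<sqsubseteq>\<^bsub>N\<^esub> n \<longleftrightarrow> (\<forall>(a, b)\<in>U. f a \<sqinter>\<^bsub>N\<^esub> g b \<sqsubseteq>\<^bsub>N\<^esub> n)"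
  by (simp add: k_eq N.le_sup_iff image_closed) auto

lemma le_k: "\<lbrakk>coprod_ideal L M U; (a, b) \<in> U\<rbrakk> \<Longrightarrow> f a \<sqinter>\<^bsub>N\<^esub> g b \<sqsubseteq>\<^bsub>N\<^esub> k U"
  using k_le_iff[of U "k U"] by auto

lemma k_mono: "\<lbrakk>coprod_ideal L M U; coprod_ideal L M V; U \<subseteq> V\<rbrakk> \<Longrightarrow> k U \<sqsubseteq>\<^bsub>N\<^esub> k V"
  by (auto simp: k_le_iff intro: le_k)

lemma ideal_below:
  assumes n: "n \<in> carrier N"
  shows "coprod_ideal L M {(a, b). a \<in> carrier L \<and> b \<in> carrier M \<and> f a \<sqinter>\<^bsub>N\<^esub> g b \<sqsubseteq>\<^bsub>N\<^esub> n}"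
proof (rule idealI, goal_cases)
  case (2 x y a b)
  then have "f a \<sqinter>\<^bsub>N\<^esub> g b \<sqsubseteq>\<^bsub>N\<^esub> f x \<sqinter>\<^bsub>N\<^esub> g y"
    by (intro N.meet_mono) (auto intro: frame_homD(5)[OF f] frame_homD(5)[OF g])
  with 2 n show ?case by (auto intro: N.le_trans)
next
  case (3 A y)
  have "g y \<sqinter>\<^bsub>N\<^esub> \<Squnion>\<^bsub>N\<^esub>(f ` A) \<sqsubseteq>\<^bsub>N\<^esub> n"
    using 3 n by (intro N.meet_Sup_le) (auto simp: meet_comm[of N "g y"])
  then show ?case using 3 by (simp add: frame_homD(4)[OF f] meet_comm[of N "g y"])
next
  case (4 x B)
  have "f x \<sqinter>\<^bsub>N\<^esub> \<Squnion>\<^bsub>N\<^esub>(g ` B) \<sqsubseteq>\<^bsub>N\<^esub> n"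
    using 4 n by (intro N.meet_Sup_le) auto
  then show ?case using 4 by (simp add: frame_homD(4)[OF g])
qed auto

lemma k_hom: "k \<in> frame_hom T N"
proof (rule frame_homI[OF frame_T N.frame_axioms], goal_cases)
  case 1
  have "k \<in> extensional (carrier T)" by (simp add: copair_def del: carrier_T)
  then show ?case by (auto simp: PiE_iff)
next
  case 2
  have "f \<top>\<^bsub>L\<^esub> \<sqinter>\<^bsub>N\<^esub> g \<top>\<^bsub>M\<^esub> \<sqsubseteq>\<^bsub>N\<^esub> k (carrier L \<times> carrier M)"
    by (rule le_k[OF ideal_full]) auto
  moreover have "f \<top>\<^bsub>L\<^esub> \<sqinter>\<^bsub>N\<^esub> g \<top>\<^bsub>M\<^esub> = \<top>\<^bsub>N\<^esub>"
    using frame_homD(2)[OF f] frame_homD(2)[OF g] by (auto intro: N.meet_eqI)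
  ultimately show ?case
    using k_closed[OF ideal_full] by (auto simp: top_T intro: N.le_antisym)
next
  case (3 U V)
  then have U: "coprod_ideal L M U" and V: "coprod_ideal L M V" by auto
  have UV: "coprod_ideal L M (U \<inter> V)" by (rule ideal_Int[OF U V])
  have "f c \<sqinter>\<^bsub>N\<^esub> g e \<sqinter>\<^bsub>N\<^esub> (f a \<sqinter>\<^bsub>N\<^esub> g b) \<sqsubseteq>\<^bsub>N\<^esub> k (U \<inter> V)" if "(a, b) \<in> U" "(c, e) \<in> V" for a b c e
  proof -
    have cl: "a \<in> carrier L" "c \<in> carrier L" "b \<in> carrier M" "e \<in> carrier M"
      using that ideal_sub[OF U] ideal_sub[OF V] by auto
    have "(c \<sqinter>\<^bsub>L\<^esub> a, e \<sqinter>\<^bsub>M\<^esub> b) \<in> U \<inter> V"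
      using cl by (auto intro: ideal_down[OF U that(1)] ideal_down[OF V that(2)] L.meet_left L.meet_right M.meet_left M.meet_right)
    then have "f (c \<sqinter>\<^bsub>L\<^esub> a) \<sqinter>\<^bsub>N\<^esub> g (e \<sqinter>\<^bsub>M\<^esub> b) \<sqsubseteq>\<^bsub>N\<^esub> k (U \<inter> V)" by (rule le_k[OF UV])
    moreover have "f c \<sqinter>\<^bsub>N\<^esub> g e \<sqinter>\<^bsub>N\<^esub> (f a \<sqinter>\<^bsub>N\<^esub> g b) = f (c \<sqinter>\<^bsub>L\<^esub> a) \<sqinter>\<^bsub>N\<^esub> g (e \<sqinter>\<^bsub>M\<^esub> b)"
      using cl by (simp add: frame_homD(3)[OF f] frame_homD(3)[OF g] N.meet_assoc)
        (metis N.meet_assoc meet_comm f_closed g_closed N.meet_closed)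
    ultimately show ?thesis by simp
  qed
  then have *: "k V \<sqinter>\<^bsub>N\<^esub> (f a \<sqinter>\<^bsub>N\<^esub> g b) \<sqsubseteq>\<^bsub>N\<^esub> k (U \<inter> V)" if ab: "(a, b) \<in> U" for a b
  proof -
    have cl: "f a \<sqinter>\<^bsub>N\<^esub> g b \<in> carrier N" using ab ideal_sub[OF U] by auto
    have "(f a \<sqinter>\<^bsub>N\<^esub> g b) \<sqinter>\<^bsub>N\<^esub> k V \<sqsubseteq>\<^bsub>N\<^esub> k (U \<inter> V)"
      unfolding k_eq[OF V]
      using ab cl UV \<open>\<And>a b c e. (a, b) \<in> U \<Longrightarrow> (c, e) \<in> V \<Longrightarrow> f c \<sqinter>\<^bsub>N\<^esub> g e \<sqinter>\<^bsub>N\<^esub> (f a \<sqinter>\<^bsub>N\<^esub> g b) \<sqsubseteq>\<^bsub>N\<^esub> k (U \<inter> V)\<close>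
      by (intro N.meet_Sup_le image_closed V) (auto simp: meet_comm[of N "f a \<sqinter>\<^bsub>N\<^esub> g b"])
    then show ?thesis by (simp add: meet_comm)
  qed
  have "k V \<sqinter>\<^bsub>N\<^esub> k U \<sqsubseteq>\<^bsub>N\<^esub> k (U \<inter> V)"
    unfolding k_eq[OF U] using * UV V by (intro N.meet_Sup_le image_closed U) auto
  then have "k U \<sqinter>\<^bsub>N\<^esub> k V \<sqsubseteq>\<^bsub>N\<^esub> k (U \<inter> V)" by (simp add: meet_comm)
  moreover have "k (U \<inter> V) \<sqsubseteq>\<^bsub>N\<^esub> k U \<sqinter>\<^bsub>N\<^esub> k V"
    using U V UV by (intro N.meet_le k_mono) auto
  ultimately show ?case
    using U V UV by (simp add: meet_T) (auto intro: N.le_antisym)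
next
  case (4 \<U>)
  then have UU: "\<U> \<subseteq> Collect (coprod_ideal L M)" by auto
  have S: "coprod_ideal L M (\<Squnion>\<^bsub>T\<^esub>\<U>)" by (rule sup_T_ideal[OF UU])
  have img: "k ` \<U> \<subseteq> carrier N" using UU by auto
  let ?n = "\<Squnion>\<^bsub>N\<^esub>(k ` \<U>)"
  have n: "?n \<in> carrier N" using img by simp
  have "\<Squnion>\<^bsub>T\<^esub>\<U> \<subseteq> {(a, b). a \<in> carrier L \<and> b \<in> carrier M \<and> f a \<sqinter>\<^bsub>N\<^esub> g b \<sqsubseteq>\<^bsub>N\<^esub> ?n}"
  proof (rule sup_T_least[OF UU ideal_below[OF n]], safe)
    fix U a b assume U: "U \<in> \<U>" and ab: "(a, b) \<in> U"
    have iU: "coprod_ideal L M U" using U UU by auto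
    show cl: "a \<in> carrier L" "b \<in> carrier M" using ab ideal_sub[OF iU] by auto
    have "k U \<sqsubseteq>\<^bsub>N\<^esub> ?n" using U by (intro N.sup_upper[OF img]) auto
    then show "f a \<sqinter>\<^bsub>N\<^esub> g b \<sqsubseteq>\<^bsub>N\<^esub> ?n"
      using n iU ab k_le_iff by auto
  qed
  then have "k (\<Squnion>\<^bsub>T\<^esub>\<U>) \<sqsubseteq>\<^bsub>N\<^esub> ?n" using S n by (auto simp: k_le_iff)
  moreover have "?n \<sqsubseteq>\<^bsub>N\<^esub> k (\<Squnion>\<^bsub>T\<^esub>\<U>)"
    using S UU by (intro N.sup_least[OF img]) (auto intro!: k_mono sup_T_upper[OF UU])
  ultimately show ?case using S n by (auto intro: N.le_antisym)
qed

lemma k_inj1: "compose (carrier L) k (coprod_inj1 L M) = f"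
proof (rule extensionalityI[of _ "carrier L"])
  fix x assume x: "x \<in> carrier L"
  let ?U = "coprod_inj1 L M x"
  have U: "coprod_ideal L M ?U" by (rule ideal_inj1[OF x])
  have "f x \<sqinter>\<^bsub>N\<^esub> g \<top>\<^bsub>M\<^esub> \<sqsubseteq>\<^bsub>N\<^esub> k ?U"
    by (rule le_k[OF U]) (use x in \<open>auto simp: coprod_inj1_def\<close>)
  moreover have "f x \<sqinter>\<^bsub>N\<^esub> g \<top>\<^bsub>M\<^esub> = f x"
    using frame_homD(2)[OF g] x by (auto intro: N.meet_eqI)
  moreover have "f a \<sqinter>\<^bsub>N\<^esub> g b \<sqsubseteq>\<^bsub>N\<^esub> f x" if "(a, b) \<in> ?U" for a b
  proof -
    have ab: "a \<in> carrier L" "b \<in> carrier M" "a \<sqsubseteq>\<^bsub>L\<^esub> x \<or> b = \<bottom>\<^bsub>M\<^esub>"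
      using that x by (auto simp: coprod_inj1_def)
    then have "f a \<sqsubseteq>\<^bsub>N\<^esub> f x \<or> g b \<sqsubseteq>\<^bsub>N\<^esub> f x" using x by (auto simp: g_bot frame_homD(5)[OF f])
    then show ?thesis
      using ab(1,2) x by (auto intro: N.meet_le1 N.meet_le2)
  qed
  then have "k ?U \<sqsubseteq>\<^bsub>N\<^esub> f x" using x by (auto simp: k_le_iff[OF U])
  ultimately show "compose (carrier L) k (coprod_inj1 L M) x = f x"
    using x U by (auto simp: compose_eq intro: N.le_antisym)
qed (use frame_homD(1)[OF f] in \<open>auto simp: PiE_iff\<close>)

lemma k_inj2: "compose (carrier M) k (coprod_inj2 L M) = g"
proof (rule extensionalityI[of _ "carrier M"])
  fix y assume y: "y \<in> carrier M"
  let ?U = "coprod_inj2 L M y"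
  have U: "coprod_ideal L M ?U" by (rule ideal_inj2[OF y])
  have "f \<top>\<^bsub>L\<^esub> \<sqinter>\<^bsub>N\<^esub> g y \<sqsubseteq>\<^bsub>N\<^esub> k ?U"
    by (rule le_k[OF U]) (use y in \<open>auto simp: coprod_inj2_def\<close>)
  moreover have "f \<top>\<^bsub>L\<^esub> \<sqinter>\<^bsub>N\<^esub> g y = g y"
    using frame_homD(2)[OF f] y by (auto intro: N.meet_eqI)
  moreover have "f a \<sqinter>\<^bsub>N\<^esub> g b \<sqsubseteq>\<^bsub>N\<^esub> g y" if "(a, b) \<in> ?U" for a b
  proof -
    have ab: "a \<in> carrier L" "b \<in> carrier M" "b \<sqsubseteq>\<^bsub>M\<^esub> y \<or> a = \<bottom>\<^bsub>L\<^esub>"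
      using that y by (auto simp: coprod_inj2_def)
    then have "f a \<sqsubseteq>\<^bsub>N\<^esub> g y \<or> g b \<sqsubseteq>\<^bsub>N\<^esub> g y" using y by (auto simp: f_bot frame_homD(5)[OF g])
    then show ?thesis
      using ab(1,2) y by (auto intro: N.meet_le1 N.meet_le2)
  qed
  then have "k ?U \<sqsubseteq>\<^bsub>N\<^esub> g y" using y by (auto simp: k_le_iff[OF U])
  ultimately show "compose (carrier M) k (coprod_inj2 L M) y = g y"
    using y U by (auto simp: compose_eq intro: N.le_antisym)
qed (use frame_homD(1)[OF g] in \<open>auto simp: PiE_iff\<close>)

lemma k_unique:
  assumes j: "j \<in> frame_hom T N" and "compose (carrier L) j (coprod_inj1 L M) = f"
    "compose (carrier M) j (coprod_inj2 L M) = g"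
  shows "j = k"
proof (rule extensionalityI[of _ "carrier T"])
  show "j \<in> extensional (carrier T)" using frame_homD(1)[OF j] by (auto simp: PiE_iff)
  show "k \<in> extensional (carrier T)" using frame_homD(1)[OF k_hom] by (auto simp: PiE_iff)
  fix U assume "U \<in> carrier T"
  then have U: "coprod_ideal L M U" by simp
  have r: "j (rectangle L M a b) = f a \<sqinter>\<^bsub>N\<^esub> g b" if "(a, b) \<in> U" for a b
  proof -
    have "a \<in> carrier L" "b \<in> carrier M" using that ideal_sub[OF U] by auto
    then show ?thesis unfolding rectangle_def assms(2,3)[symmetric]
      by (simp add: frame_homD(3)[OF j] ideal_inj1 ideal_inj2 compose_eq)
  qed
  have "j U = j (\<Squnion>\<^bsub>T\<^esub>((\<lambda>(a, b). rectangle L M a b) ` U))" by (simp add: Sup_rectangles[OF U])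
  also have "\<dots> = \<Squnion>\<^bsub>N\<^esub>(j ` (\<lambda>(a, b). rectangle L M a b) ` U)"
    using ideal_sub[OF U] by (intro frame_homD(4)[OF j]) (auto simp: ideal_rectangle)
  also have "j ` (\<lambda>(a, b). rectangle L M a b) ` U = (\<lambda>(a, b). f a \<sqinter>\<^bsub>N\<^esub> g b) ` U"
    unfolding image_image by (rule image_cong) (auto simp: r)
  finally show "j U = k U" by (simp add: k_eq[OF U])
qed

end

theorem frame_tensor_coproduct:
  fixes L :: "'a gorder" and M :: "'b gorder" and N :: "'c gorder"
  assumes "frame L" "frame M"
  shows "frame (frame_tensor L M)"
    and "coprod_inj1 L M \<in> frame_hom L (frame_tensor L M)"
    and "coprod_inj2 L M \<in> frame_hom M (frame_tensor L M)"
    and "\<lbrakk>frame N; f \<in> frame_hom L N; g \<in> frame_hom M N; k \<in> frame_hom (frame_tensor L M) N\<rbrakk> \<Longrightarrow>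
      compose (carrier L) k (coprod_inj1 L M) = f \<and> compose (carrier M) k (coprod_inj2 L M) = g
      \<longleftrightarrow> k = copair L M N f g"
    and "\<lbrakk>frame N; f \<in> frame_hom L N; g \<in> frame_hom M N\<rbrakk> \<Longrightarrow>
      copair L M N f g \<in> frame_hom (frame_tensor L M) N"
proof -
  interpret frame_pair L M using assms by (simp add: frame_pair_def)
  show "frame T" "coprod_inj1 L M \<in> frame_hom L T" "coprod_inj2 L M \<in> frame_hom M T"
    by (rule frame_T inj1_hom inj2_hom)+
  assume N: "frame N" "f \<in> frame_hom L N" "g \<in> frame_hom M N"
  interpret frame_cocone L M N f g
    using N by (intro frame_cocone.intro frame_cocone_axioms.intro frame_pair_axioms)
  show "copair L M N f g \<in> frame_hom T N" by (rule k_hom)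
  assume "k \<in> frame_hom T N"
  then show "compose (carrier L) k (coprod_inj1 L M) = f \<and> compose (carrier M) k (coprod_inj2 L M) = g
      \<longleftrightarrow> k = copair L M N f g"
    using k_inj1 k_inj2 k_unique by blast
qed


section \<open>Localic relations with open cones\<close>

text \<open>\<open>left_adjoint X Y h l\<close>: the map \<open>l : \<O>X \<rightarrow> \<O>Y\<close> is left adjoint to \<open>h : \<O>Y \<rightarrow> \<O>X\<close>.\<close>

definition left_adjoint :: "'a gorder \<Rightarrow> 'b gorder \<Rightarrow> ('b \<Rightarrow> 'a) \<Rightarrow> ('a \<Rightarrow> 'b) \<Rightarrow> bool" where
  "left_adjoint X Y h l \<longleftrightarrow>
     l \<in> carrier X \<rightarrow>\<^sub>E carrier Y \<and>
     galois_connection \<lparr>orderA = X, orderB = Y, lower = l, upper = h\<rparr>"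

definition open_map :: "'a gorder \<Rightarrow> 'b gorder \<Rightarrow> ('b \<Rightarrow> 'a) \<Rightarrow> bool" where
  "open_map X Y h \<longleftrightarrow>
     h \<in> frame_hom Y X \<and>
     (\<exists>l. left_adjoint X Y h l \<and>
          (\<forall>U\<in>carrier X. \<forall>V\<in>carrier Y. l (U \<sqinter>\<^bsub>X\<^esub> h V) = l U \<sqinter>\<^bsub>Y\<^esub> V))"

definition direct_image :: "'a gorder \<Rightarrow> 'b gorder \<Rightarrow> ('b \<Rightarrow> 'a) \<Rightarrow> 'a \<Rightarrow> 'b" where
  "direct_image X Y h = (THE l. left_adjoint X Y h l)"

text \<open>A locale together with a sublocale of its square, the latter being represented by a surjective
  frame map \<open>rel_map : \<O>X \<otimes> \<O>X \<rightarrow> \<O>R\<close>.\<close>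

record ('a, 'r) rel_locale =
  opens :: "'a gorder"
  rel_opens :: "'r gorder"
  rel_map :: "('a \<times> 'a) set \<Rightarrow> 'r"

definition localic_relation :: "('a, 'r) rel_locale \<Rightarrow> bool" where
  "localic_relation X \<longleftrightarrow>
     frame (opens X) \<and> frame (rel_opens X) \<and>
     rel_map X \<in> frame_hom (frame_tensor (opens X) (opens X)) (rel_opens X) \<and>
     rel_map X ` carrier (frame_tensor (opens X) (opens X)) = carrier (rel_opens X)"

definition source :: "('a, 'r) rel_locale \<Rightarrow> 'a \<Rightarrow> 'r" where
  "source X = compose (carrier (opens X)) (rel_map X) (coprod_inj1 (opens X) (opens X))"

definition target :: "('a, 'r) rel_locale \<Rightarrow> 'a \<Rightarrow> 'r" where
  "target X = compose (carrier (opens X)) (rel_map X) (coprod_inj2 (opens X) (opens X))"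

definition open_cones :: "('a, 'r) rel_locale \<Rightarrow> bool" where
  "open_cones X \<longleftrightarrow>
     open_map (rel_opens X) (opens X) (source X) \<and> open_map (rel_opens X) (opens X) (target X)"

definition up_cone :: "('a, 'r) rel_locale \<Rightarrow> 'a \<Rightarrow> 'a" where
  "up_cone X =
     compose (carrier (opens X)) (direct_image (rel_opens X) (opens X) (target X)) (source X)"

definition down_cone :: "('a, 'r) rel_locale \<Rightarrow> 'a \<Rightarrow> 'a" where
  "down_cone X =
     compose (carrier (opens X)) (direct_image (rel_opens X) (opens X) (source X)) (target X)"

text \<open>Monotone maps \<open>X \<rightarrow> Y\<close>, given by their frame maps \<open>\<O>Y \<rightarrow> \<O>X\<close>; \<open>k\<close> is the frame map of the
  map between the relations.\<close>

definition monotone_maps :: "('a, 'r) rel_locale \<Rightarrow> ('b, 's) rel_locale \<Rightarrow> ('b \<Rightarrow> 'a) set" where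
  "monotone_maps X Y = {h \<in> frame_hom (opens Y) (opens X).
     \<exists>k\<in>frame_hom (rel_opens Y) (rel_opens X).
       \<forall>z\<in>carrier (frame_tensor (opens Y) (opens Y)).
         k (rel_map Y z) = rel_map X (square_map (opens X) (opens Y) h z)}"

definition rocLoc :: "(('a, 'r) rel_locale, 'a \<Rightarrow> 'a) category" where
  "rocLoc = \<lparr>Obj = {X. localic_relation X \<and> open_cones X},
     Hom = monotone_maps,
     Ident = (\<lambda>X. \<lambda>x\<in>carrier (opens X). x),
     Comp = (\<lambda>X Y Z g f. compose (carrier (opens Z)) f g)\<rparr>"


section \<open>Conic frames\<close>

record 'a conic_frame =
  frm :: "'a gorder"
  ucone :: "'a \<Rightarrow> 'a"
  dcone :: "'a \<Rightarrow> 'a"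

definition parallel :: "'a gorder \<Rightarrow> ('a \<Rightarrow> 'a) \<Rightarrow> ('a \<Rightarrow> 'a) \<Rightarrow> bool" where
  "parallel L u d \<longleftrightarrow>
     (\<forall>x\<in>carrier L. \<forall>y\<in>carrier L.
        u x \<sqinter>\<^bsub>L\<^esub> y \<sqsubseteq>\<^bsub>L\<^esub> u (x \<sqinter>\<^bsub>L\<^esub> d y) \<and> x \<sqinter>\<^bsub>L\<^esub> d y \<sqsubseteq>\<^bsub>L\<^esub> d (u x \<sqinter>\<^bsub>L\<^esub> y))"

definition conic_frame :: "'a conic_frame \<Rightarrow> bool" where
  "conic_frame K \<longleftrightarrow>
     frame (frm K) \<and>
     ucone K \<in> carrier (frm K) \<rightarrow>\<^sub>E carrier (frm K) \<and> sup_pres (frm K) (frm K) (ucone K) \<and>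
     dcone K \<in> carrier (frm K) \<rightarrow>\<^sub>E carrier (frm K) \<and> sup_pres (frm K) (frm K) (dcone K) \<and>
     parallel (frm K) (ucone K) (dcone K)"

definition conic_hom :: "'a conic_frame \<Rightarrow> 'b conic_frame \<Rightarrow> ('a \<Rightarrow> 'b) set" where
  "conic_hom K J = {h \<in> frame_hom (frm K) (frm J).
     \<forall>x\<in>carrier (frm K). ucone J (h x) \<sqsubseteq>\<^bsub>frm J\<^esub> h (ucone K x) \<and>
                         dcone J (h x) \<sqsubseteq>\<^bsub>frm J\<^esub> h (dcone K x)}"

definition ConFrm :: "('a conic_frame, 'a \<Rightarrow> 'a) category" where
  "ConFrm = \<lparr>Obj = {K. conic_frame K},
     Hom = conic_hom,
     Ident = (\<lambda>K. \<lambda>x\<in>carrier (frm K). x),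
     Comp = (\<lambda>K J I g f. compose (carrier (frm K)) g f)\<rparr>"


section \<open>The induced relation of a conic frame\<close>

definition cone_sim :: "'a conic_frame \<Rightarrow> ('a \<times> 'a) set \<Rightarrow> ('a \<times> 'a) set \<Rightarrow> bool" where
  "cone_sim K p q \<longleftrightarrow>
     (\<exists>a\<in>carrier (frm K). \<exists>b\<in>carrier (frm K). \<exists>c\<in>carrier (frm K). \<exists>e\<in>carrier (frm K).
        p = rectangle (frm K) (frm K) a b \<and> q = rectangle (frm K) (frm K) c e \<and>
        ucone K a \<sqinter>\<^bsub>frm K\<^esub> b = ucone K c \<sqinter>\<^bsub>frm K\<^esub> e \<and>
        a \<sqinter>\<^bsub>frm K\<^esub> dcone K b = c \<sqinter>\<^bsub>frm K\<^esub> dcone K e)"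

definition saturated :: "'a conic_frame \<Rightarrow> ('a \<times> 'a) set set" where
  "saturated K = (let T = frame_tensor (frm K) (frm K) in
     {z \<in> carrier T. \<forall>p q. cone_sim K p q \<longrightarrow>
        (\<forall>w\<in>carrier T. p \<sqinter>\<^bsub>T\<^esub> w \<sqsubseteq>\<^bsub>T\<^esub> z \<longleftrightarrow> q \<sqinter>\<^bsub>T\<^esub> w \<sqsubseteq>\<^bsub>T\<^esub> z)})"

definition saturation :: "'a conic_frame \<Rightarrow> ('a \<times> 'a) set \<Rightarrow> ('a \<times> 'a) set" where
  "saturation K = (let T = frame_tensor (frm K) (frm K) in
     (\<lambda>z\<in>carrier T. THE m. least T m {y \<in> saturated K. z \<sqsubseteq>\<^bsub>T\<^esub> y}))"

definition induced_relation :: "'a conic_frame \<Rightarrow> ('a, ('a \<times> 'a) set) rel_locale" where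
  "induced_relation K =
     \<lparr>opens = frm K,
      rel_opens = (frame_tensor (frm K) (frm K))\<lparr>carrier := saturated K\<rparr>,
      rel_map = saturation K\<rparr>"


section \<open>The functors\<close>

text \<open>Both functors are the identity on the frame maps by which arrows are represented.
  The frame of the relation \<open>induced_relation K\<close> consists of elements of \<open>L \<otimes> L\<close>, so \<open>rel\<close> takes
  values in locales over a type \<open>'a\<close> whose relations are over the type \<open>('a \<times> 'a) set\<close>; since every
  quotient of \<open>\<O>X \<otimes> \<O>X\<close> is isomorphic to one carried by a subset of it, this is no restriction on
  the relations.\<close>

definition cone :: "(('a, 'r) rel_locale, 'a \<Rightarrow> 'a, 'a conic_frame, 'a \<Rightarrow> 'a) cat_fun" where
  "cone = \<lparr>fobj = (\<lambda>X. \<lparr>frm = opens X, ucone = up_cone X, dcone = down_cone X\<rparr>),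
     fmap = (\<lambda>X Y h. h)\<rparr>"

definition rel ::
  "('a conic_frame, 'a \<Rightarrow> 'a, ('a, ('a \<times> 'a) set) rel_locale, 'a \<Rightarrow> 'a) cat_fun" where
  "rel = \<lparr>fobj = induced_relation, fmap = (\<lambda>K J h. h)\<rparr>"

end

(* The cones of (X, R) are computed by u(a) meet b = t_!(s^-1(a) meet t^-1(b)) and
   a meet d(b) = s_!(s^-1(a) meet t^-1(b)); hence the frame map onto the opens of R takes the same
   value on the rectangles of (a, b) and of (a meet d(b), u(a) meet b). Conversely, parallelism says
   exactly that these two rectangles are related by ~, and an ideal is ~-saturated as soon as it
   is closed under passing from the second to the first. So s^-1(x) and t^-1(y) for the induced
   relation are {(a, b). a meet d(b) <= x} and {(a, b). u(a) meet b <= y}, from which left adjoints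
   and the equation cone(rel K) = K are read off, and a frame map h is conic from K to
   cone(X, R) iff it is monotone from (X, R) to rel K. *)

theory Submission
  imports Defs
begin

section \<open>Open maps\<close>

text \<open>Both functors keep the representing frame maps, so functor laws, naturality and
  triangles are equations between identities and extensional functions. The content is membership in
  hom-sets, and the hard membership is \<open>monotone_maps\<close> into an induced relation: a
  frame map out of a quotient has to be produced, while \<open>saturated\<close> tests ideals
  against all related pairs and all \<open>w\<close>. A closure rule can replace that test because
  the reduction \<open>(a, b) \<mapsto> (a \<sqinter> d b, u a \<sqinter> b)\<close> is monotone:
  cutting a pair by another pair before reducing only makes the result smaller. Hence implications
  into saturated ideals are saturated, which yields both the frame law for saturated ideals and the
  preservation of meets by saturation. The same rule lets a frame map descend to the quotient after
  a check on rectangles only.\<close>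

lemma left_adjoint_le_iff:
  "\<lbrakk>left_adjoint X Y h l; U \<in> carrier X; V \<in> carrier Y\<rbrakk> \<Longrightarrow> l U \<sqsubseteq>\<^bsub>Y\<^esub> V \<longleftrightarrow> U \<sqsubseteq>\<^bsub>X\<^esub> h V"
  using galois_connection.galois_property[of "\<lparr>orderA = X, orderB = Y, lower = l, upper = h\<rparr>" U V]
  by (simp add: left_adjoint_def)

lemma left_adjointI:
  assumes "frame X" "frame Y" "h \<in> carrier Y \<rightarrow> carrier X" "l \<in> carrier X \<rightarrow>\<^sub>E carrier Y"
    and "\<And>U V. \<lbrakk>U \<in> carrier X; V \<in> carrier Y\<rbrakk> \<Longrightarrow> l U \<sqsubseteq>\<^bsub>Y\<^esub> V \<longleftrightarrow> U \<sqsubseteq>\<^bsub>X\<^esub> h V"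
  shows "left_adjoint X Y h l"
proof -
  interpret X: frame X by fact
  interpret Y: frame Y by fact
  show ?thesis
    using assms X.partial_order_axioms Y.partial_order_axioms
    by (auto simp: left_adjoint_def galois_connection_def connection_def
        galois_connection_axioms_def PiE_iff)
qed

text \<open>Each adjoint is below the other by transposing the other's unit. The extensional domain
  demanded by \<open>left_adjoint\<close> turns agreement on \<open>carrier X\<close> into equality
  of HOL functions, which the definite description in \<open>direct_image\<close> requires.\<close>

lemma left_adjoint_unique:
  assumes "frame Y" and l: "left_adjoint X Y h l" and m: "left_adjoint X Y h m"
  shows "l = m"
proof (rule extensionalityI)
  interpret Y: frame Y by fact
  have lm: "l \<in> carrier X \<rightarrow>\<^sub>E carrier Y" "m \<in> carrier X \<rightarrow>\<^sub>E carrier Y"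
    using l m by (auto simp: left_adjoint_def)
  then show "l \<in> extensional (carrier X)" "m \<in> extensional (carrier X)"
    by (auto simp: PiE_iff)
  fix U assume U: "U \<in> carrier X"
  with lm have c: "l U \<in> carrier Y" "m U \<in> carrier Y" by auto
  have "l U \<sqsubseteq>\<^bsub>Y\<^esub> m U"
    using left_adjoint_le_iff[OF l U c(2)] left_adjoint_le_iff[OF m U c(2)] c by simp
  moreover have "m U \<sqsubseteq>\<^bsub>Y\<^esub> l U"
    using left_adjoint_le_iff[OF l U c(1)] left_adjoint_le_iff[OF m U c(1)] c by simp
  ultimately show "l U = m U" using c by (blast intro: Y.le_antisym)
qed

lemma direct_image_eq: "frame Y \<Longrightarrow> left_adjoint X Y h l \<Longrightarrow> direct_image X Y h = l"
  unfolding direct_image_def by (blast intro: left_adjoint_unique)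

text \<open>Both sides have the same upper bounds, since transposition turns each bound
  \<open>y\<close> into the bound \<open>h y\<close> in \<open>X\<close>. This is the source of join
  preservation for the cones.\<close>

lemma left_adjoint_Sup:
  assumes "frame X" "frame Y" and l: "left_adjoint X Y h l" and A: "A \<subseteq> carrier X"
  shows "l (\<Squnion>\<^bsub>X\<^esub>A) = \<Squnion>\<^bsub>Y\<^esub>(l ` A)"
proof -
  interpret X: frame X by fact
  interpret Y: frame Y by fact
  have lc: "l U \<in> carrier Y" if "U \<in> carrier X" for U
    using l that by (auto simp: left_adjoint_def)
  have hc: "h V \<in> carrier X" if "V \<in> carrier Y" for V
    using l that by (auto simp: left_adjoint_def galois_connection_def connection_def)
  have img: "l ` A \<subseteq> carrier Y" using A lc by auto
  have S: "\<Squnion>\<^bsub>X\<^esub>A \<in> carrier X" using A by simp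
  have iff: "l (\<Squnion>\<^bsub>X\<^esub>A) \<sqsubseteq>\<^bsub>Y\<^esub> y \<longleftrightarrow> (\<forall>a\<in>A. l a \<sqsubseteq>\<^bsub>Y\<^esub> y)" if y: "y \<in> carrier Y" for y
  proof -
    have "l a \<sqsubseteq>\<^bsub>Y\<^esub> y \<longleftrightarrow> a \<sqsubseteq>\<^bsub>X\<^esub> h y" if "a \<in> A" for a
      using that A by (intro left_adjoint_le_iff[OF l _ y]) auto
    then show ?thesis
      using A by (simp add: left_adjoint_le_iff[OF l S y] X.le_sup_iff hc y)
  qed
  show ?thesis
    using iff[of "l (\<Squnion>\<^bsub>X\<^esub>A)"] iff lc[OF S]
    by (intro Y.sup_eqI[symmetric] img lc S) auto
qed

locale open_frame_map = X: frame X + Y: frame Y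
  for X :: "'a gorder" and Y :: "'b gorder" +
  fixes h :: "'b \<Rightarrow> 'a"
  assumes "open_map X Y h"
begin

abbreviation "h_lower \<equiv> direct_image X Y h"

lemma hom: "h \<in> frame_hom Y X"
  using open_frame_map_axioms by (simp add: open_frame_map_def open_frame_map_axioms_def
    open_map_def)

lemma h_closed [simp]: "V \<in> carrier Y \<Longrightarrow> h V \<in> carrier X"
  using frame_homD(1)[OF hom] by auto

text \<open>Openness provides some adjoint with the Frobenius law; uniqueness of adjoints transfers
  the law to \<open>direct_image\<close>.\<close>

lemma adj: "left_adjoint X Y h h_lower"
 
    and frobenius: "\<lbrakk>U \<in> carrier X; V \<in> carrier Y\<rbrakk> \<Longrightarrow> h_lower (U \<sqinter>\<^bsub>X\<^esub> h V) = h_lower U \<sqinter>\<^bsub>Y\<^esub> V"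
proof -
  obtain l where l: "left_adjoint X Y h l"
    and "\<forall>U\<in>carrier X. \<forall>V\<in>carrier Y. l (U \<sqinter>\<^bsub>X\<^esub> h V) = l U \<sqinter>\<^bsub>Y\<^esub> V"
    using open_frame_map_axioms
    by (auto simp: open_frame_map_def open_frame_map_axioms_def open_map_def)
  moreover have "h_lower = l" by (rule direct_image_eq[OF Y.frame_axioms l])
  ultimately show "left_adjoint X Y h h_lower"
    and "\<lbrakk>U \<in> carrier X; V \<in> carrier Y\<rbrakk> \<Longrightarrow> h_lower (U \<sqinter>\<^bsub>X\<^esub> h V) = h_lower U \<sqinter>\<^bsub>Y\<^esub> V"
    by auto
qed

lemma lower_closed [simp]: "U \<in> carrier X \<Longrightarrow> h_lower U \<in> carrier Y"
  using adj by (auto simp: left_adjoint_def)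

lemmas lower_le_iff = left_adjoint_le_iff[OF adj]
lemmas lower_Sup = left_adjoint_Sup[OF X.frame_axioms Y.frame_axioms adj]

lemma unit: "U \<in> carrier X \<Longrightarrow> U \<sqsubseteq>\<^bsub>X\<^esub> h (h_lower U)"
  using lower_le_iff[of U "h_lower U"] by simp

lemma lower_mono: "\<lbrakk>U \<in> carrier X; V \<in> carrier X; U \<sqsubseteq>\<^bsub>X\<^esub> V\<rbrakk> \<Longrightarrow> h_lower U \<sqsubseteq>\<^bsub>Y\<^esub> h_lower V"
  using unit[of V] by (auto simp: lower_le_iff intro: X.le_trans)

end

section \<open>Composites and identities of frame maps\<close>

lemma compose_frame_hom:
  assumes "f \<in> frame_hom L M" "g \<in> frame_hom M N"
  shows "compose (carrier L) g f \<in> frame_hom L N"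
proof -
  have fr: "f \<in> carrier L \<rightarrow>\<^sub>E carrier M" "g \<in> carrier M \<rightarrow>\<^sub>E carrier N"
    by (rule frame_homD(1)[OF assms(1)] frame_homD(1)[OF assms(2)])+
  have lat: "complete_lattice L" "complete_lattice N"
    using assms by (auto simp: frame_hom_def sup_pres_def)
  interpret L: complete_lattice L by fact
  interpret N: complete_lattice N by fact
  have "compose (carrier L) g f ` A = g ` f ` A" if "A \<subseteq> carrier L" for A
    using that by (force simp: compose_def)
  moreover have "f ` A \<subseteq> carrier M" if "A \<subseteq> carrier L" for A using fr that by auto
  ultimately have "sup_pres L N (compose (carrier L) g f)"
    using fr lat by (auto simp: sup_pres_def compose_eq frame_homD(4)[OF assms(1)]
      frame_homD(4)[OF assms(2)])
  moreover have "meet_pres L N (compose (carrier L) g f)"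
    using fr L.lattice_axioms N.lattice_axioms
    by (auto simp: meet_pres_def compose_eq frame_homD(3)[OF assms(1)] frame_homD(3)[OF
      assms(2)] PiE_iff)
  moreover have "compose (carrier L) g f \<in> carrier L \<rightarrow>\<^sub>E carrier N"
    using fr by (auto simp: compose_def)
  ultimately show ?thesis
    by (simp add: frame_hom_def compose_eq frame_homD(2)[OF assms(1)] frame_homD(2)[OF assms(2)])
qed

lemma id_frame_hom: "frame L \<Longrightarrow> (\<lambda>x\<in>carrier L. x) \<in> frame_hom L L"
proof -
  assume L: "frame L"
  interpret L: frame L by fact
  have "(\<lambda>x\<in>carrier L. x) ` A = A" if "A \<subseteq> carrier L" for A
    using that by (force simp: subset_eq)
  then show ?thesis
    using L by (intro frame_homI) auto
qed

section \<open>The categories of relations and of conic frames\<close>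

text \<open>The injections are jointly epic: \<open>f\<close> and \<open>g\<close> both mediate the
  cocone that \<open>f\<close> itself induces, so uniqueness identifies them.\<close>

lemma frame_tensor_hom_eqI:
  assumes "frame L" "frame M" "frame N" and f: "f \<in> frame_hom (frame_tensor L M) N"
    and g: "g \<in> frame_hom (frame_tensor L M) N"
    and 1: "\<And>x. x \<in> carrier L \<Longrightarrow> f (coprod_inj1 L M x) = g (coprod_inj1 L M x)"
    and 2: "\<And>y. y \<in> carrier M \<Longrightarrow> f (coprod_inj2 L M y) = g (coprod_inj2 L M y)"
  shows "f = g"
proof -
  note inj = frame_tensor_coproduct(2,3)[OF assms(1,2)]
  let ?f1 = "compose (carrier L) f (coprod_inj1 L M)"
  let ?f2 = "compose (carrier M) f (coprod_inj2 L M)"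
  have h: "?f1 \<in> frame_hom L N" "?f2 \<in> frame_hom M N"
    by (rule compose_frame_hom[OF inj(1) f] compose_frame_hom[OF inj(2) f])+
  have e: "compose (carrier L) g (coprod_inj1 L M) = ?f1"
    "compose (carrier M) g (coprod_inj2 L M) = ?f2"
    using 1 2 by (auto simp: compose_def restrict_def)
  note uniq = frame_tensor_coproduct(4)[OF assms(1-3) h]
  from uniq[OF f] uniq[OF g] e show ?thesis by simp
qed

text \<open>The values on the two injections are all that is ever used of \<open>square_map\<close>;
  they determine it by \<open>frame_tensor_hom_eqI\<close>, so the join in \<open>copair\<close>
  need not be evaluated.\<close>

lemma square_map_frame_hom:
  assumes X: "frame X" and Y: "frame Y" and h: "h \<in> frame_hom Y X"
  shows "square_map X Y h \<in> frame_hom (frame_tensor Y Y) (frame_tensor X X)"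
    and "x \<in> carrier Y \<Longrightarrow> square_map X Y h (coprod_inj1 Y Y x) = coprod_inj1 X X (h x)"
    and "x \<in> carrier Y \<Longrightarrow> square_map X Y h (coprod_inj2 Y Y x) = coprod_inj2 X X (h x)"
proof -
  note T = frame_tensor_coproduct(1)[OF X X]
  have i: "compose (carrier Y) (coprod_inj1 X X) h \<in> frame_hom Y (frame_tensor X X)"
    "compose (carrier Y) (coprod_inj2 X X) h \<in> frame_hom Y (frame_tensor X X)"
    using compose_frame_hom[OF h] frame_tensor_coproduct(2,3)[OF X X] by blast+
  show s: "square_map X Y h \<in> frame_hom (frame_tensor Y Y) (frame_tensor X X)"
    unfolding square_map_def by (rule frame_tensor_coproduct(5)[OF Y Y T i])
  have "compose (carrier Y) (square_map X Y h) (coprod_inj1 Y Y) = compose (carrier Y) (coprod_inj1 X X) h"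
    "compose (carrier Y) (square_map X Y h) (coprod_inj2 Y Y) = compose (carrier Y) (coprod_inj2 X X) h"
    using frame_tensor_coproduct(4)[OF Y Y T i s] by (simp_all add: square_map_def)
  then show "x \<in> carrier Y \<Longrightarrow> square_map X Y h (coprod_inj1 Y Y x) = coprod_inj1 X X (h x)"
    "x \<in> carrier Y \<Longrightarrow> square_map X Y h (coprod_inj2 Y Y x) = coprod_inj2 X X (h x)"
    by (metis compose_eq)+
qed

section \<open>Localic relations and monotone maps\<close>

locale localic_rel =
  fixes X :: "('a, 'r) rel_locale"
  assumes localic_relation: "localic_relation X"
begin

lemma frames: "frame (opens X)" "frame (rel_opens X)"
  and rel_map_hom: "rel_map X \<in> frame_hom (frame_tensor (opens X) (opens X)) (rel_opens X)"
  using localic_relation by (simp_all add: localic_relation_def)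

lemma source_hom: "source X \<in> frame_hom (opens X) (rel_opens X)"
  and target_hom: "target X \<in> frame_hom (opens X) (rel_opens X)"
  unfolding source_def target_def
  by (rule compose_frame_hom[OF _ rel_map_hom], rule frame_tensor_coproduct[OF frames(1)
    frames(1)])+

lemma source_eq:
  "x \<in> carrier (opens X) \<Longrightarrow> source X x = rel_map X (coprod_inj1 (opens X) (opens X) x)"
 
    and target_eq: "x \<in> carrier (opens X) \<Longrightarrow> target X x = rel_map X (coprod_inj2 (opens X) (opens X) x)"
  by (simp_all add: source_def target_def compose_eq)

end

text \<open>By the universal property of \<open>\<O>Y \<otimes> \<O>Y\<close>, the square defining monotonicity commutes as soon
  as it does after composition with the projections, which eliminates \<open>square_map\<close>.\<close>

lemma monotone_maps_iff:
  assumes "localic_relation X" "localic_relation Y"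
  shows "h \<in> monotone_maps X Y \<longleftrightarrow>
    h \<in> frame_hom (opens Y) (opens X) \<and>
    (\<exists>k\<in>frame_hom (rel_opens Y) (rel_opens X).
      \<forall>x\<in>carrier (opens Y). k (source Y x) = source X (h x) \<and> k (target Y x) = target X (h x))"
    (is "_ \<longleftrightarrow> _ \<and> (\<exists>k\<in>_. ?P k)")
proof (cases "h \<in> frame_hom (opens Y) (opens X)")
  case True
  interpret X: localic_rel X by unfold_locales fact
  interpret Y: localic_rel Y by unfold_locales fact
  let ?T = "frame_tensor (opens Y) (opens Y)"
  note sq = square_map_frame_hom[OF X.frames(1) Y.frames(1) True]
  have hc: "h x \<in> carrier (opens X)" if "x \<in> carrier (opens Y)" for x
    using frame_homD(1)[OF True] that by auto
  have inj: "coprod_inj1 (opens Y) (opens Y) x \<in> carrier ?T"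
    "coprod_inj2 (opens Y) (opens Y) x \<in> carrier ?T"
    if "x \<in> carrier (opens Y)" for x
    using that frame_tensor_coproduct(2,3)[OF Y.frames(1) Y.frames(1), THEN frame_homD(1)] by auto
  have "(\<forall>z\<in>carrier ?T. k (rel_map Y z) = rel_map X (square_map (opens X) (opens Y) h z)) \<longleftrightarrow> ?P k"
    (is "?Q \<longleftrightarrow> _")
    if k: "k \<in> frame_hom (rel_opens Y) (rel_opens X)" for k
  proof
    assume ?Q
    then show "?P k"
      by (simp add: X.source_eq Y.source_eq X.target_eq Y.target_eq hc inj sq)
  next
    assume P: "?P k"
    have eq: "compose (carrier ?T) k (rel_map Y) = compose (carrier ?T) (rel_map X) (square_map (opens X) (opens Y) h)"
      using P by (intro frame_tensor_hom_eqI[OF Y.frames(1) Y.frames(1) X.frames(2)]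
          compose_frame_hom[OF Y.rel_map_hom k] compose_frame_hom[OF sq(1) X.rel_map_hom])
        (auto simp: compose_eq inj sq X.source_eq Y.source_eq X.target_eq Y.target_eq hc)
    show ?Q
    proof
      fix z assume "z \<in> carrier ?T"
      then show "k (rel_map Y z) = rel_map X (square_map (opens X) (opens Y) h z)"
        using fun_cong[OF eq, of z] by (simp only: compose_eq)
    qed
  qed
  with True show ?thesis by (auto simp: monotone_maps_def)
qed (simp add: monotone_maps_def)

lemma compose_monotone_maps:
  assumes X: "localic_relation X" and Y: "localic_relation Y" and Z: "localic_relation Z"
    and f: "f \<in> monotone_maps X Y" and g: "g \<in> monotone_maps Y Z"
  shows "compose (carrier (opens Z)) f g \<in> monotone_maps X Z"
proof -
  interpret Z: localic_rel Z by unfold_locales fact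
  obtain k where f': "f \<in> frame_hom (opens Y) (opens X)"
    and k: "k \<in> frame_hom (rel_opens Y) (rel_opens X)"
    and kc: "\<And>x. x \<in> carrier (opens Y) \<Longrightarrow> k (source Y x) = source X (f x) \<and> k (target Y x) = target X (f x)"
    using f unfolding monotone_maps_iff[OF X Y] by blast
  obtain l where g': "g \<in> frame_hom (opens Z) (opens Y)"
    and l: "l \<in> frame_hom (rel_opens Z) (rel_opens Y)"
    and lc: "\<And>x. x \<in> carrier (opens Z) \<Longrightarrow> l (source Z x) = source Y (g x) \<and> l (target Z x) = target Y (g x)"
    using g unfolding monotone_maps_iff[OF Y Z] by blast
  have gc: "g x \<in> carrier (opens Y)" if "x \<in> carrier (opens Z)" for x
    using frame_homD(1)[OF g'] that by auto
  have sc: "source Z x \<in> carrier (rel_opens Z)" "target Z x \<in> carrier (rel_opens Z)" if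
    "x \<in> carrier (opens Z)" for x
    using that frame_homD(1)[OF Z.source_hom] frame_homD(1)[OF Z.target_hom] by auto
  show ?thesis
    unfolding monotone_maps_iff[OF X Z]
    using kc lc gc sc compose_frame_hom[OF l k] compose_frame_hom[OF g' f']
    by (auto simp: compose_eq intro!: bexI[of _ "compose (carrier (rel_opens Z)) k l"])
qed

lemma id_monotone_map:
  assumes X: "localic_relation X"
  shows "(\<lambda>x\<in>carrier (opens X). x) \<in> monotone_maps X X"
proof -
  interpret X: localic_rel X by unfold_locales fact
  have sc: "source X x \<in> carrier (rel_opens X)" "target X x \<in> carrier (rel_opens X)" if
    "x \<in> carrier (opens X)" for x
    using that frame_homD(1)[OF X.source_hom] frame_homD(1)[OF X.target_hom] by auto
  show ?thesis
    unfolding monotone_maps_iff[OF X X]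
    using sc X.frames by (auto intro: id_frame_hom intro!: bexI[of _ "\<lambda>x\<in>carrier (rel_opens X). x"])
qed

lemma category_rocLoc: "category rocLoc"
proof (unfold_locales, goal_cases)
  case (2 X Y Z f g)
  then show ?case using compose_monotone_maps[of X Y Z f g] by (simp add: rocLoc_def)
next
  case (3 X Y f)
  then have "f \<in> carrier (opens Y) \<rightarrow>\<^sub>E carrier (opens X)"
    by (auto simp: rocLoc_def monotone_maps_def frame_hom_def)
  then show ?case by (intro ext) (auto simp: rocLoc_def compose_def restrict_def PiE_iff
    extensional_def)
next
  case (4 X Y f)
  then have "f \<in> carrier (opens Y) \<rightarrow>\<^sub>E carrier (opens X)"
    by (auto simp: rocLoc_def monotone_maps_def frame_hom_def)
  then show ?case by (intro ext) (auto simp: rocLoc_def compose_def restrict_def PiE_iff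
    extensional_def)
next
  case (5 W X Y Z f g h)
  then have "h \<in> carrier (opens Z) \<rightarrow>\<^sub>E carrier (opens Y)"
    by (auto simp: rocLoc_def monotone_maps_def frame_hom_def)
  then show ?case by (intro ext) (auto simp: rocLoc_def compose_def restrict_def PiE_iff
    extensional_def)
qed (simp add: rocLoc_def id_monotone_map)

lemma category_op_cat:
  assumes "category C" shows "category (op_cat C)"
proof -
  interpret category C by fact
  show ?thesis
  proof (unfold_locales, goal_cases)
    case (2 X Y Z f g)
    then show ?case using Comp_in_Hom[of Z Y X g f] by (simp add: op_cat_def)
  next
    case (5 W X Y Z f g h)
    then show ?case using Comp_assoc[of Z Y X W h g f] by (simp add: op_cat_def)
  qed (simp_all add: op_cat_def Ident_in_Hom Comp_Ident_left Comp_Ident_right)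
qed

section \<open>Conic morphisms\<close>

lemma conic_frame_closed:
  assumes "conic_frame K" "x \<in> carrier (frm K)"
  shows "ucone K x \<in> carrier (frm K)" "dcone K x \<in> carrier (frm K)"
proof -
  have "ucone K \<in> carrier (frm K) \<rightarrow>\<^sub>E carrier (frm K)" "dcone K \<in> carrier (frm K) \<rightarrow>\<^sub>E carrier (frm K)"
    using assms by (simp_all add: conic_frame_def)
  then show "ucone K x \<in> carrier (frm K)" "dcone K x \<in> carrier (frm K)"
    using assms(2) by auto
qed

lemma compose_conic_hom:
  assumes f: "f \<in> conic_hom K J" and g: "g \<in> conic_hom J I"
    and "conic_frame K" "conic_frame J" "conic_frame I"
  shows "compose (carrier (frm K)) g f \<in> conic_hom K I"
proof -
  interpret I: frame "frm I" using assms by (simp add: conic_frame_def)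
  have f': "f \<in> frame_hom (frm K) (frm J)" and g': "g \<in> frame_hom (frm J) (frm I)"
    using f g by (auto simp: conic_hom_def)
  have fc: "f x \<in> carrier (frm J)" if "x \<in> carrier (frm K)" for x
    using frame_homD(1)[OF f'] that by auto
  have gc: "g x \<in> carrier (frm I)" if "x \<in> carrier (frm J)" for x
    using frame_homD(1)[OF g'] that by auto
  note c = conic_frame_closed[OF assms(3)] conic_frame_closed[OF assms(4)] conic_frame_closed[OF
    assms(5)]
  have "ucone I (g (f x)) \<sqsubseteq>\<^bsub>frm I\<^esub> g (f (ucone K x)) \<and> dcone I (g (f x)) \<sqsubseteq>\<^bsub>frm I\<^esub> g (f (dcone K x))"
    if x: "x \<in> carrier (frm K)" for x
  proof
    have "ucone I (g (f x)) \<sqsubseteq>\<^bsub>frm I\<^esub> g (ucone J (f x))"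
      using g fc[OF x] by (auto simp: conic_hom_def)
    moreover have "g (ucone J (f x)) \<sqsubseteq>\<^bsub>frm I\<^esub> g (f (ucone K x))"
      using f x by (intro frame_homD(5)[OF g']) (auto simp: conic_hom_def fc c)
    ultimately show "ucone I (g (f x)) \<sqsubseteq>\<^bsub>frm I\<^esub> g (f (ucone K x))"
      by (rule I.le_trans) (simp_all add: x fc gc c)
    have "dcone I (g (f x)) \<sqsubseteq>\<^bsub>frm I\<^esub> g (dcone J (f x))"
      using g fc[OF x] by (auto simp: conic_hom_def)
    moreover have "g (dcone J (f x)) \<sqsubseteq>\<^bsub>frm I\<^esub> g (f (dcone K x))"
      using f x by (intro frame_homD(5)[OF g']) (auto simp: conic_hom_def fc c)
    ultimately show "dcone I (g (f x)) \<sqsubseteq>\<^bsub>frm I\<^esub> g (f (dcone K x))"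
      by (rule I.le_trans) (simp_all add: x fc gc c)
  qed
  then show ?thesis
    using compose_frame_hom[OF f' g'] c by (simp add: conic_hom_def compose_eq)
qed

lemma id_conic_hom:
  assumes "conic_frame K"
  shows "(\<lambda>x\<in>carrier (frm K). x) \<in> conic_hom K K"
proof -
  interpret frame "frm K" using assms by (simp add: conic_frame_def)
  show ?thesis using conic_frame_closed[OF assms] by
    (simp add: conic_hom_def id_frame_hom[OF frame_axioms])
qed

lemma category_ConFrm: "category ConFrm"
proof (unfold_locales, goal_cases)
  case (2 K J I f g)
  then show ?case using compose_conic_hom[of f K J g I] by (simp add: ConFrm_def)
next
  case (3 K J f)
  then have "f \<in> carrier (frm K) \<rightarrow>\<^sub>E carrier (frm J)"
    by (auto simp: ConFrm_def conic_hom_def frame_hom_def)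
  then show ?case by (intro ext) (auto simp: ConFrm_def compose_def restrict_def PiE_iff
    extensional_def)
next
  case (4 K J f)
  then have "f \<in> carrier (frm K) \<rightarrow>\<^sub>E carrier (frm J)"
    by (auto simp: ConFrm_def conic_hom_def frame_hom_def)
  then show ?case by (intro ext) (auto simp: ConFrm_def compose_def restrict_def PiE_iff
    extensional_def)
next
  case (5 K J I H f g h)
  then have "f \<in> carrier (frm K) \<rightarrow>\<^sub>E carrier (frm J)"
    by (auto simp: ConFrm_def conic_hom_def frame_hom_def)
  then show ?case by (intro ext) (auto simp: ConFrm_def compose_def restrict_def PiE_iff
    extensional_def)
qed (simp add: ConFrm_def id_conic_hom)

section \<open>The cones of an open relation\<close>

locale roc_locale = localic_rel X for X :: "('a, 'r) rel_locale" +
  assumes open_cones: "open_cones X"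

text \<open>The two legs are instances of one locale, so every fact on open maps is available twice.
  In both, the prefix \<open>X\<close> refers to the frame of the relation and \<open>Y\<close> to
  the frame of the underlying locale.\<close>

sublocale roc_locale \<subseteq> s: open_frame_map "rel_opens X" "opens X" "source X"
  using open_cones frames by (intro open_frame_map.intro open_frame_map_axioms.intro)
    (simp_all add: open_cones_def)

sublocale roc_locale \<subseteq> t: open_frame_map "rel_opens X" "opens X" "target X"
  using open_cones frames by (intro open_frame_map.intro open_frame_map_axioms.intro)
    (simp_all add: open_cones_def)

context roc_locale
begin

lemma up_cone_eq: "x \<in> carrier (opens X) \<Longrightarrow> up_cone X x = t.h_lower (source X x)"
  and down_cone_eq: "x \<in> carrier (opens X) \<Longrightarrow> down_cone X x = s.h_lower (target X x)"
  by (simp_all add: up_cone_def down_cone_def compose_eq)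

lemma up_cone_closed: "up_cone X \<in> carrier (opens X) \<rightarrow>\<^sub>E carrier (opens X)"
  and down_cone_closed: "down_cone X \<in> carrier (opens X) \<rightarrow>\<^sub>E carrier (opens X)"
  by (auto simp: up_cone_def down_cone_def compose_def)

lemmas cone_closed [simp] = up_cone_closed[THEN PiE_mem] down_cone_closed[THEN PiE_mem]

text \<open>Frobenius reciprocity, for \<open>t\<close> at \<open>source X x\<close> and, after
  commuting the meets, for \<open>s\<close> at \<open>target X y\<close>. The right-hand sides are
  the direct images of one and the same open of the relation along the two legs.\<close>

lemma up_cone_meet:
  "\<lbrakk>x \<in> carrier (opens X); y \<in> carrier (opens X)\<rbrakk> \<Longrightarrow>
    up_cone X x \<sqinter>\<^bsub>opens X\<^esub> y = t.h_lower (source X x \<sqinter>\<^bsub>rel_opens X\<^esub> target X y)"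
 
  and meet_down_cone: "\<lbrakk>x \<in> carrier (opens X); y \<in> carrier (opens X)\<rbrakk> \<Longrightarrow>
    x \<sqinter>\<^bsub>opens X\<^esub> down_cone X y = s.h_lower (source X x \<sqinter>\<^bsub>rel_opens X\<^esub> target X y)"
   apply (simp add: up_cone_eq t.frobenius)
  apply (simp add: down_cone_eq meet_comm[of _ x] meet_comm[of _ "source X x"] s.frobenius)
  done

text \<open>The identity through which every pair identified by \<open>cone_sim\<close> is identified in \<open>\<O>R\<close>.\<close>

lemma source_meet_target:
  assumes x: "x \<in> carrier (opens X)" and y: "y \<in> carrier (opens X)"
  shows "source X (x \<sqinter>\<^bsub>opens X\<^esub> down_cone X y) \<sqinter>\<^bsub>rel_opens X\<^esub> target X (up_cone X x \<sqinter>\<^bsub>opens X\<^esub> y) =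
    source X x \<sqinter>\<^bsub>rel_opens X\<^esub> target X y" (is "?l = ?r")
proof (rule s.X.le_antisym)
  \<comment> \<open>The units of the two adjunctions put \<open>?r\<close> below the inverse images
    of its own direct images, and these direct images are the two meets occurring in
    \<open>?l\<close>. The converse is monotonicity.\<close>
  show "?r \<sqsubseteq>\<^bsub>rel_opens X\<^esub> ?l"
    using x y s.unit[of ?r] t.unit[of ?r]
    by (intro s.X.meet_le) (simp_all add: up_cone_meet meet_down_cone)
  show "?l \<sqsubseteq>\<^bsub>rel_opens X\<^esub> ?r"
    using x y
    by (intro s.X.meet_mono frame_homD(5)[OF source_hom] frame_homD(5)[OF target_hom]
      s.Y.meet_left s.Y.meet_right) simp_all
qed (use x y in auto)

text \<open>For parallelism, \<open>source_meet_target\<close> rewrites the open under the direct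
  image as a meet of an inverse image along \<open>s\<close> and one along \<open>t\<close>;
  dropping one of them leaves exactly a cone. Joins are preserved because each cone is a frame map
  followed by a left adjoint.\<close>

lemma conic_frame_cone: "conic_frame (fobj cone X)"
proof -
  have "up_cone X x \<sqinter>\<^bsub>opens X\<^esub> y \<sqsubseteq>\<^bsub>opens X\<^esub> up_cone X (x \<sqinter>\<^bsub>opens X\<^esub> down_cone X y)"
    "x \<sqinter>\<^bsub>opens X\<^esub> down_cone X y \<sqsubseteq>\<^bsub>opens X\<^esub> down_cone X (up_cone X x \<sqinter>\<^bsub>opens X\<^esub> y)"
    if x: "x \<in> carrier (opens X)" and y: "y \<in> carrier (opens X)" for x y
  proof -
    have "up_cone X x \<sqinter>\<^bsub>opens X\<^esub> y =
        t.h_lower (source X (x \<sqinter>\<^bsub>opens X\<^esub> down_cone X y) \<sqinter>\<^bsub>rel_opens X\<^esub> target X (up_cone X x \<sqinter>\<^bsub>opens X\<^esub> y))"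
      unfolding source_meet_target[OF x y] by (rule up_cone_meet[OF x y])
    also have "\<dots> \<sqsubseteq>\<^bsub>opens X\<^esub> up_cone X (x \<sqinter>\<^bsub>opens X\<^esub> down_cone X y)"
      using x y by (simp add: up_cone_eq[of "x \<sqinter>\<^bsub>opens X\<^esub> down_cone X y"] t.lower_mono s.X.meet_left)
    finally show "up_cone X x \<sqinter>\<^bsub>opens X\<^esub> y \<sqsubseteq>\<^bsub>opens X\<^esub> up_cone X (x \<sqinter>\<^bsub>opens X\<^esub> down_cone X y)" .
    have "x \<sqinter>\<^bsub>opens X\<^esub> down_cone X y =
        s.h_lower (source X (x \<sqinter>\<^bsub>opens X\<^esub> down_cone X y) \<sqinter>\<^bsub>rel_opens X\<^esub> target X (up_cone X x \<sqinter>\<^bsub>opens X\<^esub> y))"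
      unfolding source_meet_target[OF x y] by (rule meet_down_cone[OF x y])
    also have "\<dots> \<sqsubseteq>\<^bsub>opens X\<^esub> down_cone X (up_cone X x \<sqinter>\<^bsub>opens X\<^esub> y)"
      using x y by (simp add: down_cone_eq[of "up_cone X x \<sqinter>\<^bsub>opens X\<^esub> y"] s.lower_mono s.X.meet_right)
    finally show "x \<sqinter>\<^bsub>opens X\<^esub> down_cone X y \<sqsubseteq>\<^bsub>opens X\<^esub> down_cone X (up_cone X x \<sqinter>\<^bsub>opens X\<^esub> y)" .
  qed
  moreover have "sup_pres (opens X) (opens X) (up_cone X)"
    "sup_pres (opens X) (opens X) (down_cone X)"
  proof -
    have "up_cone X (\<Squnion>\<^bsub>opens X\<^esub>A) = \<Squnion>\<^bsub>opens X\<^esub>(up_cone X ` A)"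
      "down_cone X (\<Squnion>\<^bsub>opens X\<^esub>A) = \<Squnion>\<^bsub>opens X\<^esub>(down_cone X ` A)" if A: "A \<subseteq> carrier (opens X)" for A
    proof -
      have u: "up_cone X ` A = t.h_lower ` source X ` A"
        and d: "down_cone X ` A = s.h_lower ` target X ` A"
        using A unfolding image_image by (auto intro!: image_cong simp: up_cone_eq down_cone_eq)
      show "up_cone X (\<Squnion>\<^bsub>opens X\<^esub>A) = \<Squnion>\<^bsub>opens X\<^esub>(up_cone X ` A)"
        using A unfolding u by (subst t.lower_Sup[symmetric])
          (auto simp: up_cone_eq frame_homD(4)[OF source_hom])
      show "down_cone X (\<Squnion>\<^bsub>opens X\<^esub>A) = \<Squnion>\<^bsub>opens X\<^esub>(down_cone X ` A)"
        using A unfolding d by (subst s.lower_Sup[symmetric])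
          (auto simp: down_cone_eq frame_homD(4)[OF target_hom])
    qed
    then show "sup_pres (opens X) (opens X) (up_cone X)"
      "sup_pres (opens X) (opens X) (down_cone X)"
      by (simp_all add: sup_pres_def frame_complete frames)
  qed
  ultimately show ?thesis
    using up_cone_closed down_cone_closed frames by
      (simp add: conic_frame_def cone_def parallel_def)
qed

end

text \<open>Transposed along the open leg, each conic inequality becomes the image under
  \<open>k\<close> of a unit inequality in the relation of \<open>Y\<close>; for the upper cone this
  is \<open>source Y x \<le> target Y (up_cone Y x)\<close>.\<close>

lemma monotone_map_conic_hom:
  assumes "roc_locale X" "roc_locale Y" and h: "h \<in> monotone_maps X Y"
  shows "h \<in> conic_hom (fobj cone Y) (fobj cone X)"
proof -
  interpret X: roc_locale X by fact
  interpret Y: roc_locale Y by fact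
  obtain k where h': "h \<in> frame_hom (opens Y) (opens X)"
    and k: "k \<in> frame_hom (rel_opens Y) (rel_opens X)"
    and ks: "\<And>x. x \<in> carrier (opens Y) \<Longrightarrow> source X (h x) = k (source Y x)"
    and kt: "\<And>x. x \<in> carrier (opens Y) \<Longrightarrow> target X (h x) = k (target Y x)"
    using h unfolding monotone_maps_iff[OF X.localic_relation Y.localic_relation] by auto
  have hc: "h x \<in> carrier (opens X)" if "x \<in> carrier (opens Y)" for x
    using frame_homD(1)[OF h'] that by auto
  have kc: "k z \<in> carrier (rel_opens X)" if "z \<in> carrier (rel_opens Y)" for z
    using frame_homD(1)[OF k] that by auto
  have "up_cone X (h x) \<sqsubseteq>\<^bsub>opens X\<^esub> h (up_cone Y x) \<and> down_cone X (h x) \<sqsubseteq>\<^bsub>opens X\<^esub> h (down_cone Y x)"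
    if x: "x \<in> carrier (opens Y)" for x
    using x Y.t.unit[of "source Y x"] Y.s.unit[of "target Y x"]
    by (simp add: X.up_cone_eq X.down_cone_eq Y.up_cone_eq Y.down_cone_eq hc ks kt kc
        X.t.lower_le_iff X.s.lower_le_iff frame_homD(5)[OF k])
  then show ?thesis using h' by (simp add: conic_hom_def cone_def)
qed

section \<open>Saturated ideals\<close>

locale conic =
  fixes K :: "'a conic_frame"
  assumes conic_frame: "conic_frame K"

sublocale conic \<subseteq> frame_pair "frm K" "frm K"
  using conic_frame by (simp add: conic_frame_def frame_pair_def)

context conic
begin

abbreviation "up \<equiv> ucone K"
abbreviation "down \<equiv> dcone K"
abbreviation "rect \<equiv> rectangle (frm K) (frm K)"

lemmas cone_closed [simp] = conic_frame_closed[OF conic_frame]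

lemma up_Sup: "A \<subseteq> carrier (frm K) \<Longrightarrow> up (\<Squnion>\<^bsub>frm K\<^esub>A) = \<Squnion>\<^bsub>frm K\<^esub>(up ` A)"
  and down_Sup: "A \<subseteq> carrier (frm K) \<Longrightarrow> down (\<Squnion>\<^bsub>frm K\<^esub>A) = \<Squnion>\<^bsub>frm K\<^esub>(down ` A)"
  using conic_frame by (simp_all add: conic_frame_def sup_pres_def)

lemma parallelD:
  assumes "x \<in> carrier (frm K)" "y \<in> carrier (frm K)"
  shows "up x \<sqinter>\<^bsub>frm K\<^esub> y \<sqsubseteq>\<^bsub>frm K\<^esub> up (x \<sqinter>\<^bsub>frm K\<^esub> down y)"
    and "x \<sqinter>\<^bsub>frm K\<^esub> down y \<sqsubseteq>\<^bsub>frm K\<^esub> down (up x \<sqinter>\<^bsub>frm K\<^esub> y)"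
  using conic_frame assms by (auto simp: conic_frame_def parallel_def)

text \<open>Serves to extract monotonicity of the cones from preservation of joins.\<close>

lemma Sup_pair:
  assumes "x \<in> carrier (frm K)" "y \<in> carrier (frm K)" "x \<sqsubseteq>\<^bsub>frm K\<^esub> y"
  shows "\<Squnion>\<^bsub>frm K\<^esub>{x, y} = y"
  using assms by (intro L.sup_eqI) auto

lemma up_mono:
  assumes "x \<in> carrier (frm K)" "y \<in> carrier (frm K)" "x \<sqsubseteq>\<^bsub>frm K\<^esub> y"
  shows "up x \<sqsubseteq>\<^bsub>frm K\<^esub> up y"
  using up_Sup[of "{x, y}"] Sup_pair[OF assms] assms L.sup_upper[of "up ` {x, y}" "up x"] by simp

lemma down_mono:
  assumes "x \<in> carrier (frm K)" "y \<in> carrier (frm K)" "x \<sqsubseteq>\<^bsub>frm K\<^esub> y"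
  shows "down x \<sqsubseteq>\<^bsub>frm K\<^esub> down y"
  using down_Sup[of "{x, y}"] Sup_pair[OF assms] assms L.sup_upper[of "down ` {x, y}" "down x"]
    by simp

text \<open>Parallelism says that \<open>up a \<sqinter> b\<close> is already below
  \<open>up (a \<sqinter> down b)\<close>, and dually, so shrinking the rectangle leaves both
  invariants of \<open>cone_sim\<close> unchanged. The sides of the smaller rectangle are these
  invariants, so it is a canonical representative: related rectangles reduce to the same
  one.\<close>

lemma rect_meet_down_up:
  assumes a: "a \<in> carrier (frm K)" and b: "b \<in> carrier (frm K)"
  shows "cone_sim K (rect (a \<sqinter>\<^bsub>frm K\<^esub> down b) (up a \<sqinter>\<^bsub>frm K\<^esub> b)) (rect a b)"
proof -
  have "up (a \<sqinter>\<^bsub>frm K\<^esub> down b) \<sqinter>\<^bsub>frm K\<^esub> (up a \<sqinter>\<^bsub>frm K\<^esub> b) = up a \<sqinter>\<^bsub>frm K\<^esub> b"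
    using a b parallelD(1)[OF a b] by (intro L.meet_eqI) auto
  moreover have "(a \<sqinter>\<^bsub>frm K\<^esub> down b) \<sqinter>\<^bsub>frm K\<^esub> down (up a \<sqinter>\<^bsub>frm K\<^esub> b) = a \<sqinter>\<^bsub>frm K\<^esub> down b"
    using a b parallelD(2)[OF a b] by (intro L.meet_eqI) auto
  ultimately show ?thesis
    using a b unfolding cone_sim_def
    by (intro bexI[of _ "a \<sqinter>\<^bsub>frm K\<^esub> down b"] bexI[of _ "up a \<sqinter>\<^bsub>frm K\<^esub> b"] bexI[of _ a] bexI[of _ b]
      conjI refl) auto
qed

text \<open>Meeting with a rectangle amounts to cutting both coordinates. The pairs with a bottom
  coordinate, which every rectangle contains, do no harm because every ideal contains them
  too.\<close>

lemma rect_meet_subset_iff: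
  assumes "a \<in> carrier (frm K)" "b \<in> carrier (frm K)" and w: "coprod_ideal (frm K) (frm K) w"
    and z: "coprod_ideal (frm K) (frm K) z"
  shows "rect a b \<inter> w \<subseteq> z \<longleftrightarrow> (\<forall>(x, y)\<in>w. (a \<sqinter>\<^bsub>frm K\<^esub> x, b \<sqinter>\<^bsub>frm K\<^esub> y) \<in> z)"
proof safe
  fix x y assume "rect a b \<inter> w \<subseteq> z" and xy: "(x, y) \<in> w"
  moreover have c: "x \<in> carrier (frm K)" "y \<in> carrier (frm K)" using xy ideal_sub[OF w] by auto
  moreover have "(a \<sqinter>\<^bsub>frm K\<^esub> x, b \<sqinter>\<^bsub>frm K\<^esub> y) \<in> w"
    using assms c by (intro ideal_down[OF w xy]) (auto intro: L.meet_right)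
  ultimately show "(a \<sqinter>\<^bsub>frm K\<^esub> x, b \<sqinter>\<^bsub>frm K\<^esub> y) \<in> z"
    using assms by (auto simp: rectangle_eq intro: L.meet_left)
next
  fix x y assume all: "\<forall>(x, y)\<in>w. (a \<sqinter>\<^bsub>frm K\<^esub> x, b \<sqinter>\<^bsub>frm K\<^esub> y) \<in> z" and r: "(x, y) \<in> rect a b" and w':
    "(x, y) \<in> w"
  from w' have c: "x \<in> carrier (frm K)" "y \<in> carrier (frm K)" using ideal_sub[OF w] by auto
  consider "x \<sqsubseteq>\<^bsub>frm K\<^esub> a" "y \<sqsubseteq>\<^bsub>frm K\<^esub> b" | "x = \<bottom>\<^bsub>frm K\<^esub>" | "y = \<bottom>\<^bsub>frm K\<^esub>"
    using r assms by (auto simp: rectangle_eq)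
  then show "(x, y) \<in> z"
  proof cases
    case 1
    have "(a \<sqinter>\<^bsub>frm K\<^esub> x, b \<sqinter>\<^bsub>frm K\<^esub> y) \<in> z" using all w' by auto
    then show ?thesis using assms c 1 by (elim ideal_down[OF z]) (auto intro: L.meet_le)
  qed (use c ideal_bot[OF z] in auto)
qed

text \<open>From left to right, a rectangle is compared with its reduction at
  \<open>w = \<top>\<close>. From right to left, the rule absorbs the quantifiers over related pairs
  and over \<open>w\<close>, because reduction is monotone and depends only on the invariants of
  \<open>cone_sim\<close>.\<close>

lemma saturated_iff:
  "z \<in> saturated K \<longleftrightarrow> coprod_ideal (frm K) (frm K) z \<and>
    (\<forall>a\<in>carrier (frm K). \<forall>b\<in>carrier (frm K).
      (a \<sqinter>\<^bsub>frm K\<^esub> down b, up a \<sqinter>\<^bsub>frm K\<^esub> b) \<in> z \<longrightarrow> (a, b) \<in> z)"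
  (is "_ \<longleftrightarrow> ?I z \<and> (\<forall>a\<in>?L. \<forall>b\<in>?L. ?P a b \<longrightarrow> _)")
proof
  assume z: "z \<in> saturated K"
  then have i: "?I z" by (simp add: saturated_def Let_def Let_def)
  have "(a, b) \<in> z" if a: "a \<in> ?L" and b: "b \<in> ?L" and P: "?P a b" for a b
  proof -
    let ?p = "rect (a \<sqinter>\<^bsub>frm K\<^esub> down b) (up a \<sqinter>\<^bsub>frm K\<^esub> b)"
    have "?p \<sqinter>\<^bsub>T\<^esub> \<top>\<^bsub>T\<^esub> \<subseteq> z \<longleftrightarrow> rect a b \<sqinter>\<^bsub>T\<^esub> \<top>\<^bsub>T\<^esub> \<subseteq> z"
      using z rect_meet_down_up[OF a b] ideal_full by (simp add: saturated_def Let_def top_T)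
    moreover have "V \<sqinter>\<^bsub>T\<^esub> \<top>\<^bsub>T\<^esub> = V" if "?I V" for V
      using that ideal_sub[OF that] ideal_full by (auto simp: meet_T top_T)
    ultimately show ?thesis
      using a b P i by (simp add: ideal_rectangle rectangle_subset_iff)
  qed
  with i show "?I z \<and> (\<forall>a\<in>?L. \<forall>b\<in>?L. ?P a b \<longrightarrow> (a, b) \<in> z)" by blast
next
  assume z: "?I z \<and> (\<forall>a\<in>?L. \<forall>b\<in>?L. ?P a b \<longrightarrow> (a, b) \<in> z)"
  have *: "rect a b \<inter> w \<subseteq> z"
    if le: "rect c e \<inter> w \<subseteq> z" and w: "?I w" and cl: "a \<in> ?L" "b \<in> ?L" "c \<in> ?L" "e \<in> ?L"
      and u: "up a \<sqinter>\<^bsub>frm K\<^esub> b = up c \<sqinter>\<^bsub>frm K\<^esub> e" and d: "a \<sqinter>\<^bsub>frm K\<^esub> down b = c \<sqinter>\<^bsub>frm K\<^esub> down e"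
    for a b c e w
    unfolding rect_meet_subset_iff[OF cl(1,2) w conjunct1[OF z]]
  proof (clarify)
    fix x y assume xy: "(x, y) \<in> w"
    then have c: "x \<in> ?L" "y \<in> ?L" using ideal_sub[OF w] by auto
    \<comment> \<open>The reduction of \<open>(?a, ?b)\<close> lies below that of
      \<open>(a, b)\<close>, which equals that of \<open>(c, e)\<close>, and its coordinates also
      lie below \<open>x\<close> and \<open>y\<close>. Hence it lies below the cut pair of
      \<open>(c, e)\<close>, known to be in \<open>z\<close>, and the rule returns
      \<open>(?a, ?b)\<close>.\<close>
    let ?a = "a \<sqinter>\<^bsub>frm K\<^esub> x" and ?b = "b \<sqinter>\<^bsub>frm K\<^esub> y"
    have "(c \<sqinter>\<^bsub>frm K\<^esub> x, e \<sqinter>\<^bsub>frm K\<^esub> y) \<in> z"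
      using le xy unfolding rect_meet_subset_iff[OF cl(3,4) w conjunct1[OF z]] by auto
    moreover have "?a \<sqinter>\<^bsub>frm K\<^esub> down ?b \<sqsubseteq>\<^bsub>frm K\<^esub> c \<sqinter>\<^bsub>frm K\<^esub> x"
    proof -
      have "?a \<sqinter>\<^bsub>frm K\<^esub> down ?b \<sqsubseteq>\<^bsub>frm K\<^esub> c \<sqinter>\<^bsub>frm K\<^esub> down e"
        using cl c unfolding d[symmetric] by (intro L.meet_mono down_mono L.meet_left) simp_all
      then have "?a \<sqinter>\<^bsub>frm K\<^esub> down ?b \<sqsubseteq>\<^bsub>frm K\<^esub> c" using cl c by (simp add: L.le_meet_iff)
      moreover have "?a \<sqinter>\<^bsub>frm K\<^esub> down ?b \<sqsubseteq>\<^bsub>frm K\<^esub> x"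
        using cl c by (intro L.meet_le1 L.meet_right) simp_all
      ultimately show ?thesis using cl c by (simp add: L.le_meet_iff)
    qed
    moreover have "up ?a \<sqinter>\<^bsub>frm K\<^esub> ?b \<sqsubseteq>\<^bsub>frm K\<^esub> e \<sqinter>\<^bsub>frm K\<^esub> y"
    proof -
      have "up ?a \<sqinter>\<^bsub>frm K\<^esub> ?b \<sqsubseteq>\<^bsub>frm K\<^esub> up c \<sqinter>\<^bsub>frm K\<^esub> e"
        using cl c unfolding u[symmetric] by (intro L.meet_mono up_mono L.meet_left) simp_all
      then have "up ?a \<sqinter>\<^bsub>frm K\<^esub> ?b \<sqsubseteq>\<^bsub>frm K\<^esub> e" using cl c by (simp add: L.le_meet_iff)
      moreover have "up ?a \<sqinter>\<^bsub>frm K\<^esub> ?b \<sqsubseteq>\<^bsub>frm K\<^esub> y"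
        using cl c by (intro L.meet_le2 L.meet_right) simp_all
      ultimately show ?thesis using cl c by (simp add: L.le_meet_iff)
    qed
    ultimately have "(?a \<sqinter>\<^bsub>frm K\<^esub> down ?b, up ?a \<sqinter>\<^bsub>frm K\<^esub> ?b) \<in> z"
      using cl c by (elim ideal_down[OF conjunct1[OF z]]) simp_all
    moreover have "?a \<in> ?L" "?b \<in> ?L" using cl c by simp_all
    ultimately show "(?a, ?b) \<in> z" using z by blast
  qed
  have "p \<inter> w \<subseteq> z \<longleftrightarrow> q \<inter> w \<subseteq> z" if pq: "cone_sim K p q" and w: "?I w" for p q w
  proof -
    obtain a b c e where cl: "a \<in> ?L" "b \<in> ?L" "c \<in> ?L" "e \<in> ?L" and p: "p = rect a b"
      "q = rect c e"
      and u: "up a \<sqinter>\<^bsub>frm K\<^esub> b = up c \<sqinter>\<^bsub>frm K\<^esub> e" and d: "a \<sqinter>\<^bsub>frm K\<^esub> down b = c \<sqinter>\<^bsub>frm K\<^esub> down e"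
      using pq unfolding cone_sim_def by blast
    show ?thesis
      unfolding p by (rule iffI) (erule *[OF _ w cl(3,4,1,2) u[symmetric] d[symmetric]], erule
        *[OF _ w cl u d])
  qed
  moreover have "?I p" "?I q" if pq: "cone_sim K p q" for p q
    using pq ideal_rectangle unfolding cone_sim_def by blast+
  ultimately show "z \<in> saturated K"
    using conjunct1[OF z] by (simp add: saturated_def Let_def meet_T)
qed

lemma saturated_ideal: "z \<in> saturated K \<Longrightarrow> coprod_ideal (frm K) (frm K) z"
  unfolding saturated_iff by blast

lemma saturatedD:
  "\<lbrakk>z \<in> saturated K; (a \<sqinter>\<^bsub>frm K\<^esub> down b, up a \<sqinter>\<^bsub>frm K\<^esub> b) \<in> z; a \<in> carrier (frm K); b \<in> carrier (frm K)\<rbrakk>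
    \<Longrightarrow> (a, b) \<in> z"
  unfolding saturated_iff by blast

text \<open>Conditions of closure pass to intersections; the full product gives the empty family its
  value.\<close>

lemma saturated_Inter:
  assumes "\<Z> \<subseteq> saturated K"
  shows "carrier (frm K) \<times> carrier (frm K) \<inter> \<Inter>\<Z> \<in> saturated K"
proof -
  have "(a, b) \<in> z" if "z \<in> \<Z>" "a \<in> carrier (frm K)" "b \<in> carrier (frm K)"
    "(a \<sqinter>\<^bsub>frm K\<^esub> down b, up a \<sqinter>\<^bsub>frm K\<^esub> b) \<in> \<Inter>\<Z>" for a b z
    using that assms by (blast intro: saturatedD[of z])
  moreover have "coprod_ideal (frm K) (frm K) z" if "z \<in> \<Z>" for z
    using that assms by (intro saturated_ideal) auto
  ultimately show ?thesis
    unfolding saturated_iff by (intro conjI ideal_Inter) blast+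
qed

lemma saturated_full: "carrier (frm K) \<times> carrier (frm K) \<in> saturated K"
  using saturated_Inter[of "{}"] by simp

lemma saturated_Int: "\<lbrakk>y \<in> saturated K; z \<in> saturated K\<rbrakk> \<Longrightarrow> y \<inter> z \<in> saturated K"
  unfolding saturated_iff using ideal_Int by blast

text \<open>The Heyting implication \<open>w \<Rightarrow> z\<close> of \<open>L \<otimes> L\<close> is saturated when \<open>z\<close> is, so that
  \<open>saturation\<close> preserves meets.\<close>

lemma saturated_imp:
  assumes w: "coprod_ideal (frm K) (frm K) w" and z: "z \<in> saturated K"
  obtains i where "i \<in> saturated K"
    "\<And>y. coprod_ideal (frm K) (frm K) y \<Longrightarrow> y \<subseteq> i \<longleftrightarrow> w \<inter> y \<subseteq> z"
proof
  let ?i = "{(a, b). a \<in> carrier (frm K) \<and> b \<in> carrier (frm K) \<and>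
    (\<forall>(c, e)\<in>w. (c \<sqinter>\<^bsub>frm K\<^esub> a, e \<sqinter>\<^bsub>frm K\<^esub> b) \<in> z)}"
  note iz = saturated_ideal[OF z]
  have "(c \<sqinter>\<^bsub>frm K\<^esub> a, e \<sqinter>\<^bsub>frm K\<^esub> b) \<in> z"
    if a: "a \<in> carrier (frm K)" and b: "b \<in> carrier (frm K)" and ce: "(c, e) \<in> w"
      and i: "(a \<sqinter>\<^bsub>frm K\<^esub> down b, up a \<sqinter>\<^bsub>frm K\<^esub> b) \<in> ?i" for a b c e
  proof (rule saturatedD[OF z])
    have c: "c \<in> carrier (frm K)" "e \<in> carrier (frm K)" using ce ideal_sub[OF w] by auto
    \<comment> \<open>This pair is reduced first and cut by \<open>(c, e)\<close> afterwards.
      Cutting first and reducing afterwards gives a smaller pair, which is what the rule for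
      \<open>z\<close> asks for.\<close>
    have "(c \<sqinter>\<^bsub>frm K\<^esub> (a \<sqinter>\<^bsub>frm K\<^esub> down b), e \<sqinter>\<^bsub>frm K\<^esub> (up a \<sqinter>\<^bsub>frm K\<^esub> b)) \<in> z" using i ce by blast
    moreover have "c \<sqinter>\<^bsub>frm K\<^esub> a \<sqinter>\<^bsub>frm K\<^esub> down (e \<sqinter>\<^bsub>frm K\<^esub> b) \<sqsubseteq>\<^bsub>frm K\<^esub> c \<sqinter>\<^bsub>frm K\<^esub> (a \<sqinter>\<^bsub>frm K\<^esub> down b)"
      using a b c by (subst L.meet_assoc[symmetric])
        (auto intro!: L.meet_mono down_mono intro: L.meet_right)
    moreover have "up (c \<sqinter>\<^bsub>frm K\<^esub> a) \<sqinter>\<^bsub>frm K\<^esub> (e \<sqinter>\<^bsub>frm K\<^esub> b) \<sqsubseteq>\<^bsub>frm K\<^esub> up a \<sqinter>\<^bsub>frm K\<^esub> (e \<sqinter>\<^bsub>frm K\<^esub> b)"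
      using a b c by (intro L.meet_mono up_mono L.meet_right L.le_refl) simp_all
    moreover have "up a \<sqinter>\<^bsub>frm K\<^esub> (e \<sqinter>\<^bsub>frm K\<^esub> b) = e \<sqinter>\<^bsub>frm K\<^esub> (up a \<sqinter>\<^bsub>frm K\<^esub> b)"
      using a b c by (metis L.meet_assoc meet_comm cone_closed(1))
    ultimately show "(c \<sqinter>\<^bsub>frm K\<^esub> a \<sqinter>\<^bsub>frm K\<^esub> down (e \<sqinter>\<^bsub>frm K\<^esub> b), up (c \<sqinter>\<^bsub>frm K\<^esub> a) \<sqinter>\<^bsub>frm K\<^esub> (e \<sqinter>\<^bsub>frm K\<^esub> b)) \<in> z"
      using a b c by (elim ideal_down[OF iz]) simp_all
    show "c \<sqinter>\<^bsub>frm K\<^esub> a \<in> carrier (frm K)" "e \<sqinter>\<^bsub>frm K\<^esub> b \<in> carrier (frm K)" using a b c by simp_all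
  qed
  then show "?i \<in> saturated K"
    unfolding saturated_iff by (intro conjI ideal_imp w iz) blast
  fix y assume y: "coprod_ideal (frm K) (frm K) y"
  show "y \<subseteq> ?i \<longleftrightarrow> w \<inter> y \<subseteq> z"
  proof
    assume i: "y \<subseteq> ?i"
    show "w \<inter> y \<subseteq> z"
    proof clarify
      fix a b assume ab: "(a, b) \<in> w" "(a, b) \<in> y"
      \<comment> \<open>The implication is evaluated with \<open>(a, b)\<close> itself as the
        element of \<open>w\<close>.\<close>
      then have "(a \<sqinter>\<^bsub>frm K\<^esub> a, b \<sqinter>\<^bsub>frm K\<^esub> b) \<in> z" using i by blast
      moreover have "a \<in> carrier (frm K)" "b \<in> carrier (frm K)" using ab ideal_sub[OF w] by auto
      ultimately show "(a, b) \<in> z" by (elim ideal_down[OF iz]) (auto intro: L.meet_le)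
    qed
  next
    assume s: "w \<inter> y \<subseteq> z"
    show "y \<subseteq> ?i"
    proof clarify
      fix a b assume ab: "(a, b) \<in> y"
      then have c: "a \<in> carrier (frm K)" "b \<in> carrier (frm K)" using ideal_sub[OF y] by auto
      have "(c \<sqinter>\<^bsub>frm K\<^esub> a, e \<sqinter>\<^bsub>frm K\<^esub> b) \<in> z" if ce: "(c, e) \<in> w" for c e
      proof -
        have "c \<in> carrier (frm K)" "e \<in> carrier (frm K)" using ce ideal_sub[OF w] by auto
        then have "(c \<sqinter>\<^bsub>frm K\<^esub> a, e \<sqinter>\<^bsub>frm K\<^esub> b) \<in> w \<inter> y"
          using c by (auto intro: ideal_down[OF w ce] ideal_down[OF y ab] L.meet_left L.meet_right)
        then show ?thesis using s by blast
      qed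
      with c show
        "a \<in> carrier (frm K) \<and> b \<in> carrier (frm K) \<and> (\<forall>(c, e)\<in>w. (c \<sqinter>\<^bsub>frm K\<^esub> a, e \<sqinter>\<^bsub>frm K\<^esub> b) \<in> z)"
        by blast
    qed
  qed
qed

subsection \<open>The induced relation\<close>

abbreviation "ideal \<equiv> coprod_ideal (frm K) (frm K)"
abbreviation "sat \<equiv> saturation K"
abbreviation "R \<equiv> rel_opens (induced_relation K)"

lemma carrier_R [simp]: "carrier R = saturated K"
  and le_R [simp]: "le R = (\<subseteq>)" and eq_R [simp]: "eq R = (=)"
  by (simp_all add: induced_relation_def)

text \<open>The intersection of all saturated ideals above \<open>z\<close> is a least one, and
  antisymmetry makes it the value of the definite description.\<close>

lemma saturation_least:
  assumes z: "ideal z"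
  shows "least T (sat z) {y \<in> saturated K. z \<subseteq> y}"
proof -
  let ?m = "carrier (frm K) \<times> carrier (frm K) \<inter> \<Inter>{y \<in> saturated K. z \<subseteq> y}"
  have m: "least T ?m {y \<in> saturated K. z \<subseteq> y}"
    using saturated_Inter[of "{y \<in> saturated K. z \<subseteq> y}"] ideal_sub[OF z] saturated_ideal
    by (auto simp: least_def)
  moreover have "m' = ?m" if "least T m' {y \<in> saturated K. z \<subseteq> y}" for m'
    using T.weak_least_unique[OF that m] by simp
  ultimately have "(THE m. least T m {y \<in> saturated K. z \<subseteq> y}) = ?m" by (rule the_equality)
  with m z show ?thesis by (simp add: saturation_def Let_def)
qed

lemma saturation_saturated: "ideal z \<Longrightarrow> sat z \<in> saturated K"
  and le_saturation: "ideal z \<Longrightarrow> z \<subseteq> sat z"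
  using saturation_least[of z] by (auto simp: least_def)

lemma saturation_subset_iff: "\<lbrakk>ideal z; y \<in> saturated K\<rbrakk> \<Longrightarrow> sat z \<subseteq> y \<longleftrightarrow> z \<subseteq> y"
  using saturation_least[of z] by (auto simp: least_def)

lemma saturation_fixed: "z \<in> saturated K \<Longrightarrow> sat z = z"
  using saturation_subset_iff[of z z] le_saturation[of z] saturated_ideal by auto

lemma saturation_eqI:
  assumes "ideal z" "y \<in> saturated K" "z \<subseteq> y" "\<And>x. \<lbrakk>x \<in> saturated K; z \<subseteq> x\<rbrakk> \<Longrightarrow> y \<subseteq> x"
  shows "sat z = y"
  using assms saturation_subset_iff[of z y] saturation_saturated[of z] le_saturation[of z] by blast

text \<open>The arguments are saturated one at a time: for saturated \<open>x\<close>, the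
  implication \<open>y \<Rightarrow> x\<close> is saturated and above \<open>z\<close>, so it is
  above \<open>sat z\<close>; then \<open>sat z \<Rightarrow> x\<close> is above \<open>y\<close>
  and so above \<open>sat y\<close>.\<close>

lemma saturation_Int:
  assumes y: "ideal y" and z: "ideal z"
  shows "sat (y \<inter> z) = sat y \<inter> sat z"
proof (rule saturation_eqI)
  show "ideal (y \<inter> z)" by (rule ideal_Int[OF y z])
  show "sat y \<inter> sat z \<in> saturated K" by (intro saturated_Int saturation_saturated y z)
  show "y \<inter> z \<subseteq> sat y \<inter> sat z" using le_saturation y z by blast
  fix x assume x: "x \<in> saturated K" and "y \<inter> z \<subseteq> x"
  note sy = saturation_saturated[OF y, THEN saturated_ideal]
  note sz = saturation_saturated[OF z, THEN saturated_ideal]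
  obtain i where i: "i \<in> saturated K" "\<And>v. ideal v \<Longrightarrow> v \<subseteq> i \<longleftrightarrow> y \<inter> v \<subseteq> x"
    by (rule saturated_imp[OF y x]) (rule that)
  have "y \<inter> sat z \<subseteq> x"
    using i(2)[OF z] i(2)[OF sz] saturation_subset_iff[OF z i(1)] \<open>y \<inter> z \<subseteq> x\<close> by simp
  moreover obtain j where j: "j \<in> saturated K" "\<And>v. ideal v \<Longrightarrow> v \<subseteq> j \<longleftrightarrow> sat z \<inter> v \<subseteq> x"
    by (rule saturated_imp[OF sz x]) (rule that)
  ultimately have "sat z \<inter> sat y \<subseteq> x"
    using j(2)[OF y] j(2)[OF sy] saturation_subset_iff[OF y j(1)] by (simp add: Int_commute)
  then show "sat y \<inter> sat z \<subseteq> x" by (simp add: Int_commute)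
qed

section \<open>The frame of saturated ideals\<close>

lemma complete_R: "complete_lattice R"
proof -
  interpret R: partial_order R
    by unfold_locales auto
  show ?thesis
  proof (rule R.complete_latticeI)
    fix \<Z> assume Z: "\<Z> \<subseteq> carrier R"
    have "carrier (frm K) \<times> carrier (frm K) \<inter> \<Inter>(Upper R \<Z>) \<in> saturated K"
      by (rule saturated_Inter) (auto simp: Upper_def)
    moreover have "z \<subseteq> carrier (frm K) \<times> carrier (frm K) \<inter> \<Inter>(Upper R \<Z>)" if "z \<in> \<Z>" for z
      using that Z ideal_sub[OF saturated_ideal, of z] by (auto simp: Upper_def)
    ultimately show "\<exists>s. least R s (Upper R \<Z>)"
      by (intro exI[of _ "carrier (frm K) \<times> carrier (frm K) \<inter> \<Inter>(Upper R \<Z>)"])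
        (auto simp: least_def Upper_def)
    have "carrier (frm K) \<times> carrier (frm K) \<inter> \<Inter>\<Z> \<in> saturated K"
      by (rule saturated_Inter) (use Z in auto)
    then show "\<exists>i. greatest R i (Lower R \<Z>)"
      using Z by (intro exI[of _ "carrier (frm K) \<times> carrier (frm K) \<inter> \<Inter>\<Z>"])
        (auto simp: greatest_def Lower_def dest: ideal_sub[OF saturated_ideal])
  qed
qed

sublocale R: complete_lattice R by (rule complete_R)

lemma meet_R:
  assumes "y \<in> saturated K" "z \<in> saturated K"
  shows "y \<sqinter>\<^bsub>R\<^esub> z = y \<inter> z"
  using R.meet_left[of y z] R.meet_right[of y z] R.meet_le[of "y \<inter> z" y z] saturated_Int[of y z]
    assms
  by auto

lemma top_R: "\<top>\<^bsub>R\<^esub> = carrier (frm K) \<times> carrier (frm K)"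
  using R.top_higher[OF saturated_full[folded carrier_R]] R.top_closed ideal_sub[OF saturated_ideal]
    by auto

lemma Sup_R_subset_iff:
  "\<lbrakk>\<Z> \<subseteq> saturated K; y \<in> saturated K\<rbrakk> \<Longrightarrow> \<Squnion>\<^bsub>R\<^esub>\<Z> \<subseteq> y \<longleftrightarrow> (\<forall>z\<in>\<Z>. z \<subseteq> y)"
  using R.sup_upper[of \<Z>] R.sup_least[of \<Z> y] by auto

lemma Sup_R_saturated: "\<Z> \<subseteq> saturated K \<Longrightarrow> \<Squnion>\<^bsub>R\<^esub>\<Z> \<in> saturated K"
  using R.sup_closed[of \<Z>] by simp

text \<open>\<open>sat\<close> is left adjoint to the inclusion of saturated ideals, hence preserves
  joins. In \<open>R\<close> meets are still intersections, but joins are saturations of those in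
  \<open>T\<close>.\<close>

lemma Sup_R:
  assumes Z: "\<Z> \<subseteq> Collect ideal"
  shows "sat (\<Squnion>\<^bsub>T\<^esub>\<Z>) = \<Squnion>\<^bsub>R\<^esub>(sat ` \<Z>)"
proof (rule saturation_eqI)
  have sZ: "sat ` \<Z> \<subseteq> saturated K" using Z saturation_saturated by auto
  show "ideal (\<Squnion>\<^bsub>T\<^esub>\<Z>)" by (rule sup_T_ideal[OF Z])
  show S: "\<Squnion>\<^bsub>R\<^esub>(sat ` \<Z>) \<in> saturated K" by (rule Sup_R_saturated[OF sZ])
  show "\<Squnion>\<^bsub>T\<^esub>\<Z> \<subseteq> \<Squnion>\<^bsub>R\<^esub>(sat ` \<Z>)"
  proof (rule sup_T_least[OF Z saturated_ideal[OF S]])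
    fix U assume U: "U \<in> \<Z>"
    then have "U \<subseteq> sat U" using Z le_saturation by auto
    also have "sat U \<subseteq> \<Squnion>\<^bsub>R\<^esub>(sat ` \<Z>)" using U Sup_R_subset_iff[OF sZ S] by auto
    finally show "U \<subseteq> \<Squnion>\<^bsub>R\<^esub>(sat ` \<Z>)" .
  qed
  fix x assume x: "x \<in> saturated K" and le: "\<Squnion>\<^bsub>T\<^esub>\<Z> \<subseteq> x"
  have "sat U \<subseteq> x" if U: "U \<in> \<Z>" for U
  proof -
    have "U \<subseteq> x" using sup_T_upper[OF Z U] le by auto
    moreover have "ideal U" using U Z by auto
    ultimately show ?thesis using saturation_subset_iff x by blast
  qed
  then show "\<Squnion>\<^bsub>R\<^esub>(sat ` \<Z>) \<subseteq> x" using Sup_R_subset_iff[OF sZ x] by auto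
qed

text \<open>The implication from \<open>y\<close> into the join of the meets is saturated and
  contains every member of the family, hence contains its join in \<open>R\<close>; that is the
  nontrivial half of distributivity.\<close>

lemma frame_R: "frame R"
proof (unfold_locales, goal_cases)
  case (1 y \<Z>)
  then have y: "y \<in> saturated K" and Z: "\<Z> \<subseteq> saturated K" by auto
  have img: "(\<lambda>z. y \<sqinter>\<^bsub>R\<^esub> z) ` \<Z> \<subseteq> saturated K" using y Z by
    (auto simp: meet_R saturated_Int subset_eq)
  have S: "\<Squnion>\<^bsub>R\<^esub>\<Z> \<in> saturated K" "\<Squnion>\<^bsub>R\<^esub>((\<lambda>z. y \<sqinter>\<^bsub>R\<^esub> z) ` \<Z>) \<in> saturated K"
    by (rule Sup_R_saturated[OF Z] Sup_R_saturated[OF img])+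
  obtain i where i: "i \<in> saturated K"
    "\<And>v. ideal v \<Longrightarrow> v \<subseteq> i \<longleftrightarrow> y \<inter> v \<subseteq> \<Squnion>\<^bsub>R\<^esub>((\<lambda>z. y \<sqinter>\<^bsub>R\<^esub> z) ` \<Z>)"
    by (rule saturated_imp[OF saturated_ideal[OF y] S(2)]) (rule that)
  have "z \<subseteq> i" if z: "z \<in> \<Z>" for z
  proof -
    have "y \<sqinter>\<^bsub>R\<^esub> z \<subseteq> \<Squnion>\<^bsub>R\<^esub>((\<lambda>z. y \<sqinter>\<^bsub>R\<^esub> z) ` \<Z>)"
      using Sup_R_subset_iff[OF img S(2)] z by auto
    then show ?thesis using i(2)[of z] y Z z saturated_ideal[of z] by (auto simp: meet_R subset_eq)
  qed
  then have "y \<inter> \<Squnion>\<^bsub>R\<^esub>\<Z> \<subseteq> \<Squnion>\<^bsub>R\<^esub>((\<lambda>z. y \<sqinter>\<^bsub>R\<^esub> z) ` \<Z>)"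
    using i(2)[OF saturated_ideal[OF S(1)]] Sup_R_subset_iff[OF Z i(1)] by auto
  moreover have "\<Squnion>\<^bsub>R\<^esub>((\<lambda>z. y \<sqinter>\<^bsub>R\<^esub> z) ` \<Z>) \<subseteq> y \<inter> \<Squnion>\<^bsub>R\<^esub>\<Z>"
  proof -
    have "z \<subseteq> \<Squnion>\<^bsub>R\<^esub>\<Z>" if "z \<in> \<Z>" for z using Sup_R_subset_iff[OF Z S(1)] that by auto
    then have "y \<sqinter>\<^bsub>R\<^esub> z \<subseteq> y \<inter> \<Squnion>\<^bsub>R\<^esub>\<Z>" if "z \<in> \<Z>" for z
      using meet_R[OF y, of z] Z that by auto
    then show ?thesis using Sup_R_subset_iff[OF img saturated_Int[OF y S(1)]] by auto
  qed
  ultimately have "y \<inter> \<Squnion>\<^bsub>R\<^esub>\<Z> = \<Squnion>\<^bsub>R\<^esub>((\<lambda>z. y \<sqinter>\<^bsub>R\<^esub> z) ` \<Z>)" by (rule equalityI)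
  then show ?case by (simp only: meet_R[OF y S(1)])
qed

lemma saturation_hom: "sat \<in> frame_hom T R"
proof (rule frame_homI[OF frame_T frame_R], goal_cases)
  case 1
  have "sat \<in> extensional (carrier T)" by (simp add: saturation_def Let_def del: carrier_T)
  then show ?case by (simp add: PiE_iff saturation_saturated)
next
  case 2
  then show ?case by (simp add: top_T top_R saturation_fixed[OF saturated_full])
next
  case (3 y z)
  then show ?case by (simp add: meet_T meet_R saturation_saturated saturation_Int)
next
  case (4 \<Z>)
  then show ?case by (simp add: Sup_R)
qed

lemma localic_relation_induced: "localic_relation (induced_relation K)"
proof -
  have "sat ` {U. ideal U} = saturated K"
    using saturation_saturated saturation_fixed saturated_ideal by force
  then show ?thesis
    using saturation_hom frame_R L.frame_axioms unfolding localic_relation_def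
    by (simp add: induced_relation_def)
qed

text \<open>The set is saturated because reduction leaves \<open>a \<sqinter> down b\<close>
  unchanged. It is least above the injection ideal because its members reduce into that ideal,
  whence the rule puts them into every saturated ideal above it.\<close>

lemma source_induced:
  assumes x: "x \<in> carrier (frm K)"
  shows "source (induced_relation K) x =
    {(a, b). a \<in> carrier (frm K) \<and> b \<in> carrier (frm K) \<and> a \<sqinter>\<^bsub>frm K\<^esub> down b \<sqsubseteq>\<^bsub>frm K\<^esub> x}" (is "_ = ?S")
proof -
  let ?I = "coprod_inj1 (frm K) (frm K) x"
  have I: "ideal ?I" by (rule ideal_inj1[OF x])
  \<comment> \<open>Accounts for the degenerate pairs \<open>(a, \<bottom>)\<close> of
    \<open>?I\<close>.\<close>
  have down_bot: "down \<bottom>\<^bsub>frm K\<^esub> = \<bottom>\<^bsub>frm K\<^esub>"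
    using down_Sup[of "{}"] by (simp add: L.sup_empty_eq)
  have S: "?S \<in> saturated K"
    unfolding saturated_iff
  proof (intro conjI ballI impI)
    show "ideal ?S"
    proof (rule idealI, goal_cases)
      case (2 c e a b)
      then have "a \<sqinter>\<^bsub>frm K\<^esub> down b \<sqsubseteq>\<^bsub>frm K\<^esub> c \<sqinter>\<^bsub>frm K\<^esub> down e"
        by (intro L.meet_mono down_mono) simp_all
      moreover have "c \<sqinter>\<^bsub>frm K\<^esub> down e \<sqsubseteq>\<^bsub>frm K\<^esub> x" using 2(1) by auto
      ultimately show ?case using 2 x by (auto elim: L.le_trans)
    next
      case (3 A y)
      have "down y \<sqinter>\<^bsub>frm K\<^esub> \<Squnion>\<^bsub>frm K\<^esub>A \<sqsubseteq>\<^bsub>frm K\<^esub> x"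
        using 3 x by (intro L.meet_Sup_le) (auto simp: meet_comm[of _ "down y"])
      then show ?case using 3 by (simp add: meet_comm[of _ "down y"])
    next
      case (4 c B)
      have "c \<sqinter>\<^bsub>frm K\<^esub> \<Squnion>\<^bsub>frm K\<^esub>(down ` B) \<sqsubseteq>\<^bsub>frm K\<^esub> x"
        using 4 x by (intro L.meet_Sup_le) auto
      then show ?case using 4 by (simp add: down_Sup)
    qed auto
    fix a b assume a: "a \<in> carrier (frm K)" and b: "b \<in> carrier (frm K)"
      and "(a \<sqinter>\<^bsub>frm K\<^esub> down b, up a \<sqinter>\<^bsub>frm K\<^esub> b) \<in> ?S"
    then have "a \<sqinter>\<^bsub>frm K\<^esub> down b \<sqinter>\<^bsub>frm K\<^esub> down (up a \<sqinter>\<^bsub>frm K\<^esub> b) \<sqsubseteq>\<^bsub>frm K\<^esub> x" by simp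
    moreover have "a \<sqinter>\<^bsub>frm K\<^esub> down b \<sqinter>\<^bsub>frm K\<^esub> down (up a \<sqinter>\<^bsub>frm K\<^esub> b) = a \<sqinter>\<^bsub>frm K\<^esub> down b"
      using a b parallelD(2)[OF a b] by (intro L.meet_eqI) auto
    ultimately show "(a, b) \<in> ?S" using a b by simp
  qed
  have "sat ?I = ?S"
  proof (rule saturation_eqI[OF I S])
    show "?I \<subseteq> ?S" using x by (auto simp: coprod_inj1_def down_bot intro: L.meet_le1 L.meet_le2)
    fix z assume z: "z \<in> saturated K" and Iz: "?I \<subseteq> z"
    show "?S \<subseteq> z"
    proof clarify
      fix a b assume a: "a \<in> carrier (frm K)" and b: "b \<in> carrier (frm K)" and
        "a \<sqinter>\<^bsub>frm K\<^esub> down b \<sqsubseteq>\<^bsub>frm K\<^esub> x"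
      then have "(a \<sqinter>\<^bsub>frm K\<^esub> down b, up a \<sqinter>\<^bsub>frm K\<^esub> b) \<in> ?I" using x by (simp add: coprod_inj1_def)
      then show "(a, b) \<in> z" using Iz a b by (blast intro: saturatedD[OF z])
    qed
  qed
  then show ?thesis using x by (simp add: source_def induced_relation_def compose_eq)
qed

text \<open>Dual to \<open>source_induced\<close>, with \<open>up a \<sqinter> b\<close> as the
  invariant.\<close>

lemma target_induced:
  assumes y: "y \<in> carrier (frm K)"
  shows "target (induced_relation K) y =
    {(a, b). a \<in> carrier (frm K) \<and> b \<in> carrier (frm K) \<and> up a \<sqinter>\<^bsub>frm K\<^esub> b \<sqsubseteq>\<^bsub>frm K\<^esub> y}" (is "_ = ?S")
proof -
  let ?I = "coprod_inj2 (frm K) (frm K) y"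
  have I: "ideal ?I" by (rule ideal_inj2[OF y])
  have up_bot: "up \<bottom>\<^bsub>frm K\<^esub> = \<bottom>\<^bsub>frm K\<^esub>"
    using up_Sup[of "{}"] by (simp add: L.sup_empty_eq)
  have S: "?S \<in> saturated K"
    unfolding saturated_iff
  proof (intro conjI ballI impI)
    show "ideal ?S"
    proof (rule idealI, goal_cases)
      case (2 c e a b)
      then have "up a \<sqinter>\<^bsub>frm K\<^esub> b \<sqsubseteq>\<^bsub>frm K\<^esub> up c \<sqinter>\<^bsub>frm K\<^esub> e"
        by (intro L.meet_mono up_mono) simp_all
      moreover have "up c \<sqinter>\<^bsub>frm K\<^esub> e \<sqsubseteq>\<^bsub>frm K\<^esub> y" using 2(1) by auto
      ultimately show ?case using 2 y by (auto elim: L.le_trans)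
    next
      case (3 A e)
      have "e \<sqinter>\<^bsub>frm K\<^esub> \<Squnion>\<^bsub>frm K\<^esub>(up ` A) \<sqsubseteq>\<^bsub>frm K\<^esub> y"
        using 3 y by (intro L.meet_Sup_le) (auto simp: meet_comm[of _ e])
      then show ?case using 3 by (simp add: up_Sup meet_comm[of _ e])
    next
      case (4 c B)
      have "up c \<sqinter>\<^bsub>frm K\<^esub> \<Squnion>\<^bsub>frm K\<^esub>B \<sqsubseteq>\<^bsub>frm K\<^esub> y"
        using 4 y by (intro L.meet_Sup_le) auto
      then show ?case using 4 by simp
    qed auto
    fix a b assume a: "a \<in> carrier (frm K)" and b: "b \<in> carrier (frm K)"
      and "(a \<sqinter>\<^bsub>frm K\<^esub> down b, up a \<sqinter>\<^bsub>frm K\<^esub> b) \<in> ?S"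
    then have "up (a \<sqinter>\<^bsub>frm K\<^esub> down b) \<sqinter>\<^bsub>frm K\<^esub> (up a \<sqinter>\<^bsub>frm K\<^esub> b) \<sqsubseteq>\<^bsub>frm K\<^esub> y" by simp
    moreover have "up (a \<sqinter>\<^bsub>frm K\<^esub> down b) \<sqinter>\<^bsub>frm K\<^esub> (up a \<sqinter>\<^bsub>frm K\<^esub> b) = up a \<sqinter>\<^bsub>frm K\<^esub> b"
      using a b parallelD(1)[OF a b] by (intro L.meet_eqI) auto
    ultimately show "(a, b) \<in> ?S" using a b by simp
  qed
  have "sat ?I = ?S"
  proof (rule saturation_eqI[OF I S])
    show "?I \<subseteq> ?S" using y by (auto simp: coprod_inj2_def up_bot intro: L.meet_le1 L.meet_le2)
    fix z assume z: "z \<in> saturated K" and Iz: "?I \<subseteq> z"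
    show "?S \<subseteq> z"
    proof clarify
      fix a b assume a: "a \<in> carrier (frm K)" and b: "b \<in> carrier (frm K)" and
        "up a \<sqinter>\<^bsub>frm K\<^esub> b \<sqsubseteq>\<^bsub>frm K\<^esub> y"
      then have "(a \<sqinter>\<^bsub>frm K\<^esub> down b, up a \<sqinter>\<^bsub>frm K\<^esub> b) \<in> ?I" using y by (simp add: coprod_inj2_def)
      then show "(a, b) \<in> z" using Iz a b by (blast intro: saturatedD[OF z])
    qed
  qed
  then show ?thesis using y by (simp add: target_def induced_relation_def compose_eq)
qed

subsection \<open>Open cones and the universal property\<close>

text \<open>Forced by \<open>target_induced\<close>: \<open>z\<close> is contained in the inverse
  image of \<open>y\<close> iff \<open>y\<close> bounds all \<open>up a \<sqinter> b\<close> with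
  \<open>(a, b) \<in> z\<close>, so the direct image has to be their join.\<close>

definition target_lower :: "('a \<times> 'a) set \<Rightarrow> 'a" where
  "target_lower = (\<lambda>z\<in>saturated K. \<Squnion>\<^bsub>frm K\<^esub>((\<lambda>(a, b). up a \<sqinter>\<^bsub>frm K\<^esub> b) ` z))"

definition source_lower :: "('a \<times> 'a) set \<Rightarrow> 'a" where
  "source_lower = (\<lambda>z\<in>saturated K. \<Squnion>\<^bsub>frm K\<^esub>((\<lambda>(a, b). a \<sqinter>\<^bsub>frm K\<^esub> down b) ` z))"

lemma lower_image_closed:
  assumes "z \<in> saturated K"
  shows "(\<lambda>(a, b). up a \<sqinter>\<^bsub>frm K\<^esub> b) ` z \<subseteq> carrier (frm K)"
    and "(\<lambda>(a, b). a \<sqinter>\<^bsub>frm K\<^esub> down b) ` z \<subseteq> carrier (frm K)"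
  using ideal_sub[OF saturated_ideal[OF assms]] by auto

lemma lower_closed [simp]:
  assumes "z \<in> saturated K"
  shows "target_lower z \<in> carrier (frm K)" "source_lower z \<in> carrier (frm K)"
  using lower_image_closed[OF assms] assms by (simp_all add: target_lower_def source_lower_def)

lemma target_lower_le_iff:
  assumes z: "z \<in> saturated K" and y: "y \<in> carrier (frm K)"
  shows "target_lower z \<sqsubseteq>\<^bsub>frm K\<^esub> y \<longleftrightarrow> (\<forall>(a, b)\<in>z. up a \<sqinter>\<^bsub>frm K\<^esub> b \<sqsubseteq>\<^bsub>frm K\<^esub> y)"
  using z y lower_image_closed(1)[OF z] by (simp add: target_lower_def L.le_sup_iff) auto

lemma source_lower_le_iff:
  assumes z: "z \<in> saturated K" and x: "x \<in> carrier (frm K)"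
  shows "source_lower z \<sqsubseteq>\<^bsub>frm K\<^esub> x \<longleftrightarrow> (\<forall>(a, b)\<in>z. a \<sqinter>\<^bsub>frm K\<^esub> down b \<sqsubseteq>\<^bsub>frm K\<^esub> x)"
  using z x lower_image_closed(2)[OF z] by (simp add: source_lower_def L.le_sup_iff) auto

lemma le_lower:
  assumes z: "z \<in> saturated K" and ab: "(a, b) \<in> z"
  shows "up a \<sqinter>\<^bsub>frm K\<^esub> b \<sqsubseteq>\<^bsub>frm K\<^esub> target_lower z" "a \<sqinter>\<^bsub>frm K\<^esub> down b \<sqsubseteq>\<^bsub>frm K\<^esub> source_lower z"
  using target_lower_le_iff[OF z lower_closed(1)[OF z]] source_lower_le_iff[OF z
    lower_closed(2)[OF z]] ab z
  by auto

lemma source_target_saturated: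
  assumes "x \<in> carrier (frm K)"
  shows "source (induced_relation K) x \<in> saturated K" "target (induced_relation K) x \<in> saturated K"
proof -
  interpret X: localic_rel "induced_relation K"
    by unfold_locales (rule localic_relation_induced)
  show "source (induced_relation K) x \<in> saturated K" "target (induced_relation K) x \<in> saturated K"
    using frame_homD(1)[OF X.target_hom] frame_homD(1)[OF X.source_hom] assms
    by (auto simp: induced_relation_def)
qed

lemma left_adjoint_lower:
  shows "left_adjoint R (frm K) (target (induced_relation K)) target_lower"
    and "left_adjoint R (frm K) (source (induced_relation K)) source_lower"
proof -
  have ext: "target_lower \<in> saturated K \<rightarrow>\<^sub>E carrier (frm K)"
    "source_lower \<in> saturated K \<rightarrow>\<^sub>E carrier (frm K)"
    using lower_closed by (auto simp: target_lower_def source_lower_def)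
  have sub: "a \<in> carrier (frm K) \<and> b \<in> carrier (frm K)" if "z \<in> saturated K" "(a, b) \<in> z" for a b z
    using that ideal_sub[OF saturated_ideal] by auto
  show "left_adjoint R (frm K) (target (induced_relation K)) target_lower"
    by (rule left_adjointI[OF frame_R L.frame_axioms])
      (use ext sub source_target_saturated in \<open>auto simp: target_lower_le_iff target_induced\<close>)
  show "left_adjoint R (frm K) (source (induced_relation K)) source_lower"
    by (rule left_adjointI[OF frame_R L.frame_axioms])
      (use ext sub source_target_saturated in \<open>auto simp: source_lower_le_iff source_induced\<close>)
qed

lemma target_frobenius:
  assumes z: "z \<in> saturated K" and y: "y \<in> carrier (frm K)"
  shows "target_lower (z \<inter> target (induced_relation K) y) = target_lower z \<sqinter>\<^bsub>frm K\<^esub> y"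
proof (rule L.meet_eqI[symmetric])
  let ?w = "z \<inter> target (induced_relation K) y"
  have w: "?w \<in> saturated K" using z y source_target_saturated by (intro saturated_Int) auto
  show c: "target_lower z \<in> carrier (frm K)" "target_lower ?w \<in> carrier (frm K)"
    "y \<in> carrier (frm K)"
    using z y w by auto
  show "target_lower ?w \<sqsubseteq>\<^bsub>frm K\<^esub> target_lower z"
    using le_lower[OF z] target_lower_le_iff[OF w c(1)] by auto
  show "target_lower ?w \<sqsubseteq>\<^bsub>frm K\<^esub> y"
    using target_lower_le_iff[OF w y] by (auto simp: target_induced[OF y])
  have *: "y \<sqinter>\<^bsub>frm K\<^esub> \<Squnion>\<^bsub>frm K\<^esub>((\<lambda>(a, b). up a \<sqinter>\<^bsub>frm K\<^esub> b) ` z) \<sqsubseteq>\<^bsub>frm K\<^esub> target_lower ?w"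
  proof (rule L.meet_Sup_le[OF y lower_image_closed(1)[OF z] c(2)], clarify)
    fix a b assume ab: "(a, b) \<in> z"
    then have cl: "a \<in> carrier (frm K)" "b \<in> carrier (frm K)"
      using ideal_sub[OF saturated_ideal[OF z]] by auto
    \<comment> \<open>Only the second coordinate is cut, so \<open>up a\<close> is unchanged and the
      contribution of the new pair is \<open>up a \<sqinter> b \<sqinter> y\<close>.\<close>
    have "(a, b \<sqinter>\<^bsub>frm K\<^esub> y) \<in> ?w"
      using cl y by (auto simp: target_induced intro: ideal_down[OF saturated_ideal[OF z] ab]
        L.meet_left L.meet_le2 L.meet_right)
    from le_lower(1)[OF w this]
    show "y \<sqinter>\<^bsub>frm K\<^esub> (up a \<sqinter>\<^bsub>frm K\<^esub> b) \<sqsubseteq>\<^bsub>frm K\<^esub> target_lower ?w"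
      using cl y by (simp add: L.meet_assoc[symmetric] meet_comm[of _ y])
  qed
  fix v assume v: "v \<in> carrier (frm K)" "v \<sqsubseteq>\<^bsub>frm K\<^esub> target_lower z" "v \<sqsubseteq>\<^bsub>frm K\<^esub> y"
  then have "v \<sqsubseteq>\<^bsub>frm K\<^esub> y \<sqinter>\<^bsub>frm K\<^esub> target_lower z" using c by (simp add: L.le_meet_iff)
  also have "\<dots> \<sqsubseteq>\<^bsub>frm K\<^esub> target_lower ?w" using * z by (simp add: target_lower_def)
  finally show "v \<sqsubseteq>\<^bsub>frm K\<^esub> target_lower ?w" using v c y by simp
qed

lemma source_frobenius:
  assumes z: "z \<in> saturated K" and x: "x \<in> carrier (frm K)"
  shows "source_lower (z \<inter> source (induced_relation K) x) = source_lower z \<sqinter>\<^bsub>frm K\<^esub> x"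
proof (rule L.meet_eqI[symmetric])
  let ?w = "z \<inter> source (induced_relation K) x"
  have w: "?w \<in> saturated K" using z x source_target_saturated by (intro saturated_Int) auto
  show c: "source_lower z \<in> carrier (frm K)" "source_lower ?w \<in> carrier (frm K)"
    "x \<in> carrier (frm K)"
    using z x w by auto
  show "source_lower ?w \<sqsubseteq>\<^bsub>frm K\<^esub> source_lower z"
    using le_lower[OF z] source_lower_le_iff[OF w c(1)] by auto
  show "source_lower ?w \<sqsubseteq>\<^bsub>frm K\<^esub> x"
    using source_lower_le_iff[OF w x] by (auto simp: source_induced[OF x])
  have *: "x \<sqinter>\<^bsub>frm K\<^esub> \<Squnion>\<^bsub>frm K\<^esub>((\<lambda>(a, b). a \<sqinter>\<^bsub>frm K\<^esub> down b) ` z) \<sqsubseteq>\<^bsub>frm K\<^esub> source_lower ?w"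
  proof (rule L.meet_Sup_le[OF x lower_image_closed(2)[OF z] c(2)], clarify)
    fix a b assume ab: "(a, b) \<in> z"
    then have cl: "a \<in> carrier (frm K)" "b \<in> carrier (frm K)"
      using ideal_sub[OF saturated_ideal[OF z]] by auto
    \<comment> \<open>Dually, the first coordinate is cut and \<open>down b\<close> is
      unchanged.\<close>
    have "(x \<sqinter>\<^bsub>frm K\<^esub> a, b) \<in> ?w"
      using cl x by (auto simp: source_induced intro: ideal_down[OF saturated_ideal[OF z] ab]
        L.meet_left L.meet_le1 L.meet_right)
    from le_lower(2)[OF w this]
    show "x \<sqinter>\<^bsub>frm K\<^esub> (a \<sqinter>\<^bsub>frm K\<^esub> down b) \<sqsubseteq>\<^bsub>frm K\<^esub> source_lower ?w"
      using cl x by (simp add: L.meet_assoc)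
  qed
  fix v assume v: "v \<in> carrier (frm K)" "v \<sqsubseteq>\<^bsub>frm K\<^esub> source_lower z" "v \<sqsubseteq>\<^bsub>frm K\<^esub> x"
  then have "v \<sqsubseteq>\<^bsub>frm K\<^esub> x \<sqinter>\<^bsub>frm K\<^esub> source_lower z" using c by (simp add: L.le_meet_iff)
  also have "\<dots> \<sqsubseteq>\<^bsub>frm K\<^esub> source_lower ?w" using * z by (simp add: source_lower_def)
  finally show "v \<sqsubseteq>\<^bsub>frm K\<^esub> source_lower ?w" using v c x by simp
qed

lemma roc_locale_induced: "roc_locale (induced_relation K)"
proof -
  interpret X: localic_rel "induced_relation K"
    by unfold_locales (rule localic_relation_induced)
  have o: "opens (induced_relation K) = frm K" by (simp add: induced_relation_def)
  have "open_cones (induced_relation K)"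
    unfolding open_cones_def open_map_def o
    using X.source_hom X.target_hom left_adjoint_lower target_frobenius source_frobenius
      source_target_saturated
    by (auto simp: o meet_R)
  then show ?thesis by unfold_locales
qed

lemma cone_induced: "fobj cone (induced_relation K) = K"
proof -
  interpret X: roc_locale "induced_relation K" by (rule roc_locale_induced)
  have o: "opens (induced_relation K) = frm K" by (simp add: induced_relation_def)
  note dir = left_adjoint_lower[THEN direct_image_eq[OF L.frame_axioms]]
  have ext: "up \<in> extensional (carrier (frm K))" "down \<in> extensional (carrier (frm K))"
    using conic_frame by (auto simp: conic_frame_def PiE_iff)
  have top: "\<top>\<^bsub>frm K\<^esub> \<sqinter>\<^bsub>frm K\<^esub> x = x" "x \<sqinter>\<^bsub>frm K\<^esub> \<top>\<^bsub>frm K\<^esub> = x" if "x \<in> carrier (frm K)" for x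
    using that by (auto intro: L.meet_eqI)
  have "up_cone (induced_relation K) = up"
  proof (rule extensionalityI[OF _ ext(1)])
    show "up_cone (induced_relation K) \<in> extensional (carrier (frm K))"
      using X.up_cone_closed by (auto simp: o PiE_iff)
    fix x assume x: "x \<in> carrier (frm K)"
    let ?S = "source (induced_relation K) x"
    have S: "?S \<in> saturated K" using x source_target_saturated by auto
    have "target_lower ?S = up x"
    proof (rule L.le_antisym)
      have "up a \<sqinter>\<^bsub>frm K\<^esub> b \<sqsubseteq>\<^bsub>frm K\<^esub> up x" if "(a, b) \<in> ?S" for a b
      proof -
        have ab: "a \<in> carrier (frm K)" "b \<in> carrier (frm K)" "a \<sqinter>\<^bsub>frm K\<^esub> down b \<sqsubseteq>\<^bsub>frm K\<^esub> x"
          using that by (auto simp: source_induced[OF x])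
        \<comment> \<open>\<open>up a \<sqinter> b \<le> up (a \<sqinter> down b)\<close> by
          parallelism, and the argument on the right is below \<open>x\<close>.\<close>
        show ?thesis
          by (rule L.le_trans[OF parallelD(1) up_mono]) (use ab x in auto)
      qed
      then show "target_lower ?S \<sqsubseteq>\<^bsub>frm K\<^esub> up x" using x S by (auto simp: target_lower_le_iff)
      \<comment> \<open>This pair contributes \<open>up x \<sqinter> \<top>\<close>, so the bound
        \<open>up x\<close> is attained.\<close>
      have m: "(x, \<top>\<^bsub>frm K\<^esub>) \<in> ?S" using x by (auto simp: source_induced intro: L.meet_left)
      show "up x \<sqsubseteq>\<^bsub>frm K\<^esub> target_lower ?S"
        using le_lower(1)[OF S m] x by (simp add: top)
    qed (use x S in auto)
    then show "up_cone (induced_relation K) x = up x"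
      using x by (simp add: X.up_cone_eq o dir)
  qed
  moreover have "down_cone (induced_relation K) = down"
  proof (rule extensionalityI[OF _ ext(2)])
    show "down_cone (induced_relation K) \<in> extensional (carrier (frm K))"
      using X.down_cone_closed by (auto simp: o PiE_iff)
    fix y assume y: "y \<in> carrier (frm K)"
    let ?S = "target (induced_relation K) y"
    have S: "?S \<in> saturated K" using y source_target_saturated by auto
    have "source_lower ?S = down y"
    proof (rule L.le_antisym)
      have "a \<sqinter>\<^bsub>frm K\<^esub> down b \<sqsubseteq>\<^bsub>frm K\<^esub> down y" if "(a, b) \<in> ?S" for a b
      proof -
        have ab: "a \<in> carrier (frm K)" "b \<in> carrier (frm K)" "up a \<sqinter>\<^bsub>frm K\<^esub> b \<sqsubseteq>\<^bsub>frm K\<^esub> y"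
          using that by (auto simp: target_induced[OF y])
        show ?thesis
          by (rule L.le_trans[OF parallelD(2) down_mono]) (use ab y in auto)
      qed
      then show "source_lower ?S \<sqsubseteq>\<^bsub>frm K\<^esub> down y" using y S by (auto simp: source_lower_le_iff)
      have m: "(\<top>\<^bsub>frm K\<^esub>, y) \<in> ?S" using y by (auto simp: target_induced intro: L.meet_right)
      show "down y \<sqsubseteq>\<^bsub>frm K\<^esub> source_lower ?S"
        using le_lower(2)[OF S m] y by (simp add: top)
    qed (use y S in auto)
    then show "down_cone (induced_relation K) y = down y"
      using y by (simp add: X.down_cone_eq o dir)
  qed
  ultimately show ?thesis by (simp add: cone_def o)
qed

text \<open>The quotient property: since elements of \<open>R\<close> are themselves ideals, the
  factor of \<open>\<phi>\<close> through \<open>sat\<close> is its restriction. One inequality in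
  \<open>inv\<close> is the whole invariance, as the reduced rectangle is contained in the original
  one.\<close>

lemma saturation_factor:
  assumes N: "frame N" and \<phi>: "\<phi> \<in> frame_hom T N"
    and inv: "\<And>a b. \<lbrakk>a \<in> carrier (frm K); b \<in> carrier (frm K)\<rbrakk> \<Longrightarrow>
      \<phi> (rect a b) \<sqsubseteq>\<^bsub>N\<^esub> \<phi> (rect (a \<sqinter>\<^bsub>frm K\<^esub> down b) (up a \<sqinter>\<^bsub>frm K\<^esub> b))"
  shows "restrict \<phi> (saturated K) \<in> frame_hom R N"
    and "ideal z \<Longrightarrow> \<phi> (sat z) = \<phi> z"
proof -
  interpret N: frame N by fact
  have cl: "\<phi> z \<in> carrier N" if "ideal z" for z
    using frame_homD(1)[OF \<phi>] that by auto
  show eq: "\<phi> (sat z) = \<phi> z" if z: "ideal z" for z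
  proof (rule N.le_antisym)
    note sz = saturated_ideal[OF saturation_saturated[OF z]]
    show "\<phi> z \<sqsubseteq>\<^bsub>N\<^esub> \<phi> (sat z)"
      using le_saturation[OF z] z sz by (intro frame_homD(5)[OF \<phi>]) auto
    \<comment> \<open>The value at \<open>\<phi> z\<close> of the right adjoint of
      \<open>\<phi>\<close>: the largest ideal sent below \<open>\<phi> z\<close>. By
      \<open>inv\<close> it is saturated, so with \<open>z\<close> it contains
      \<open>sat z\<close>.\<close>
    let ?y = "\<Squnion>\<^bsub>T\<^esub>{w. ideal w \<and> \<phi> w \<sqsubseteq>\<^bsub>N\<^esub> \<phi> z}"
    have W: "{w. ideal w \<and> \<phi> w \<sqsubseteq>\<^bsub>N\<^esub> \<phi> z} \<subseteq> Collect ideal" by auto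
    have y: "ideal ?y" by (rule sup_T_ideal[OF W])
    have "\<phi> ?y = \<Squnion>\<^bsub>N\<^esub>(\<phi> ` {w. ideal w \<and> \<phi> w \<sqsubseteq>\<^bsub>N\<^esub> \<phi> z})"
      by (rule frame_homD(4)[OF \<phi>]) auto
    also have "\<dots> \<sqsubseteq>\<^bsub>N\<^esub> \<phi> z" by (rule N.sup_least) (use cl z in auto)
    finally have le: "\<phi> ?y \<sqsubseteq>\<^bsub>N\<^esub> \<phi> z" .
    have y_iff: "w \<subseteq> ?y \<longleftrightarrow> \<phi> w \<sqsubseteq>\<^bsub>N\<^esub> \<phi> z" if w: "ideal w" for w
    proof
      assume "w \<subseteq> ?y"
      then have "\<phi> w \<sqsubseteq>\<^bsub>N\<^esub> \<phi> ?y" using w y by (intro frame_homD(5)[OF \<phi>]) auto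
      then show "\<phi> w \<sqsubseteq>\<^bsub>N\<^esub> \<phi> z" by (rule N.le_trans[OF _ le]) (use w y z cl in auto)
    next
      assume "\<phi> w \<sqsubseteq>\<^bsub>N\<^esub> \<phi> z"
      then show "w \<subseteq> ?y" using w by (intro sup_T_upper[OF W]) simp
    qed
    have "(a, b) \<in> ?y" if a: "a \<in> carrier (frm K)" and b: "b \<in> carrier (frm K)"
      and ab: "(a \<sqinter>\<^bsub>frm K\<^esub> down b, up a \<sqinter>\<^bsub>frm K\<^esub> b) \<in> ?y" for a b
    proof -
      let ?p = "rect (a \<sqinter>\<^bsub>frm K\<^esub> down b) (up a \<sqinter>\<^bsub>frm K\<^esub> b)"
      have p: "ideal ?p" "ideal (rect a b)" using a b by (simp_all add: ideal_rectangle)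
      have "?p \<subseteq> ?y" using rectangle_subset_iff[OF y] ab a b by simp
      then have "\<phi> ?p \<sqsubseteq>\<^bsub>N\<^esub> \<phi> z" using y_iff[OF p(1)] by simp
      then have "\<phi> (rect a b) \<sqsubseteq>\<^bsub>N\<^esub> \<phi> z"
        by (rule N.le_trans[OF inv[OF a b]]) (use p cl z in auto)
      then show ?thesis using rectangle_subset_iff[OF y a b] y_iff[OF p(2)] by simp
    qed
    then have sy: "?y \<in> saturated K" unfolding saturated_iff using y by blast
    have "z \<subseteq> ?y" using y_iff[OF z] cl[OF z] by simp
    then have "sat z \<subseteq> ?y" using saturation_subset_iff[OF z sy] by simp
    then show "\<phi> (sat z) \<sqsubseteq>\<^bsub>N\<^esub> \<phi> z" using y_iff[OF sz] by simp
  qed (use cl z saturated_ideal[OF saturation_saturated[OF z]] in auto)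
  show "restrict \<phi> (saturated K) \<in> frame_hom R N"
  proof (rule frame_homI[OF frame_R N], goal_cases)
    case 1 then show ?case using cl saturated_ideal by auto
  next
    case 2 then show ?case
      using frame_homD(2)[OF \<phi>] saturated_full by (simp add: top_R top_T)
  next
    case (3 y z)
    then show ?case
      using frame_homD(3)[OF \<phi>, of y z] by (simp add: meet_R saturated_Int saturated_ideal meet_T)
  next
    case (4 \<Z>)
    then have Z: "\<Z> \<subseteq> saturated K" by simp
    then have ZI: "\<Z> \<subseteq> Collect ideal" using saturated_ideal by auto
    have sZ: "sat ` \<Z> = \<Z>" using Z saturation_fixed by force
    \<comment> \<open>The two joins differ by a saturation, which \<open>\<phi>\<close> does not
      see.\<close>
    have "\<phi> (\<Squnion>\<^bsub>R\<^esub>\<Z>) = \<phi> (\<Squnion>\<^bsub>T\<^esub>\<Z>)"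
      using Sup_R[OF ZI] eq[OF sup_T_ideal[OF ZI]] by (simp add: sZ)
    also have "\<dots> = \<Squnion>\<^bsub>N\<^esub>(\<phi> ` \<Z>)" using ZI by (intro frame_homD(4)[OF \<phi>]) auto
    also have "\<phi> ` \<Z> = restrict \<phi> (saturated K) ` \<Z>" using Z by (intro image_cong) auto
    finally show ?case using Sup_R_saturated[OF Z] by simp
  qed
qed

text \<open>With \<open>monotone_map_conic_hom\<close> and \<open>cone_induced\<close>, the hom-set bijection of the adjunction, on
  representing frame maps the identity. The unit and the functoriality of \<open>rel\<close> are special cases.\<close>

lemma conic_hom_monotone_map:
  assumes "roc_locale X" and h: "h \<in> conic_hom K (fobj cone X)"
  shows "h \<in> monotone_maps X (induced_relation K)"
proof -
  interpret X: roc_locale X by fact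
  have h': "h \<in> frame_hom (frm K) (opens X)"
    and hu: "\<And>x. x \<in> carrier (frm K) \<Longrightarrow> up_cone X (h x) \<sqsubseteq>\<^bsub>opens X\<^esub> h (up x)"
    and hd: "\<And>x. x \<in> carrier (frm K) \<Longrightarrow> down_cone X (h x) \<sqsubseteq>\<^bsub>opens X\<^esub> h (down x)"
    using h by (auto simp: conic_hom_def cone_def)
  have hc [simp]: "h x \<in> carrier (opens X)" if "x \<in> carrier (frm K)" for x
    using frame_homD(1)[OF h'] that by auto
  let ?f = "compose (carrier (frm K)) (source X) h" and ?g =
    "compose (carrier (frm K)) (target X) h"
  have f: "?f \<in> frame_hom (frm K) (rel_opens X)" and g: "?g \<in> frame_hom (frm K) (rel_opens X)"
    by (rule compose_frame_hom[OF h' X.source_hom] compose_frame_hom[OF h' X.target_hom])+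
  \<comment> \<open>The frame map of \<open>(f \<times> f) \<circ> r\<close>, where \<open>h\<close>
    represents \<open>f\<close> and \<open>r\<close> is the inclusion of the relation of
    \<open>X\<close>. Monotonicity of \<open>h\<close> is its factorization through
    \<open>sat\<close>.\<close>
  let ?\<phi> = "copair (frm K) (frm K) (rel_opens X) ?f ?g"
  have \<phi>: "?\<phi> \<in> frame_hom T (rel_opens X)"
    by (rule frame_tensor_coproduct(5)[OF L.frame_axioms L.frame_axioms X.frames(2) f g])
  have e: "compose (carrier (frm K)) ?\<phi> (coprod_inj1 (frm K) (frm K)) = ?f"
    "compose (carrier (frm K)) ?\<phi> (coprod_inj2 (frm K) (frm K)) = ?g"
    using frame_tensor_coproduct(4)[OF L.frame_axioms L.frame_axioms X.frames(2) f g \<phi>] by simp_all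
  have \<phi>1: "?\<phi> (coprod_inj1 (frm K) (frm K) x) = source X (h x)"
    and \<phi>2: "?\<phi> (coprod_inj2 (frm K) (frm K) x) = target X (h x)" if "x \<in> carrier (frm K)" for x
    using fun_cong[OF e(1), of x] fun_cong[OF e(2), of x] that by (simp_all only: compose_eq)
  have \<phi>_rect: "?\<phi> (rect a b) = source X (h a) \<sqinter>\<^bsub>rel_opens X\<^esub> target X (h b)"
    if "a \<in> carrier (frm K)" "b \<in> carrier (frm K)" for a b
    using that unfolding rectangle_def
    by (subst frame_homD(3)[OF \<phi>]) (simp_all add: \<phi>1 \<phi>2 ideal_inj1 ideal_inj2)
  have "?\<phi> (rect a b) \<sqsubseteq>\<^bsub>rel_opens X\<^esub> ?\<phi> (rect (a \<sqinter>\<^bsub>frm K\<^esub> down b) (up a \<sqinter>\<^bsub>frm K\<^esub> b))"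
    if a: "a \<in> carrier (frm K)" and b: "b \<in> carrier (frm K)" for a b
  proof -
    \<comment> \<open>The reduction is made with the cones of \<open>X\<close>, where it changes
      nothing in the opens of the relation; the conic inequalities then replace these cones by the
      images of \<open>down\<close> and \<open>up\<close>.\<close>
    have "?\<phi> (rect a b) = source X (h a \<sqinter>\<^bsub>opens X\<^esub> down_cone X (h b)) \<sqinter>\<^bsub>rel_opens X\<^esub>
        target X (up_cone X (h a) \<sqinter>\<^bsub>opens X\<^esub> h b)"
      using a b by (simp add: \<phi>_rect X.source_meet_target)
    also have "\<dots> \<sqsubseteq>\<^bsub>rel_opens X\<^esub> source X (h a \<sqinter>\<^bsub>opens X\<^esub> h (down b)) \<sqinter>\<^bsub>rel_opens X\<^esub>
        target X (h (up a) \<sqinter>\<^bsub>opens X\<^esub> h b)"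
      using a b hu hd
      by (intro X.s.X.meet_mono frame_homD(5)[OF X.source_hom] frame_homD(5)[OF X.target_hom]
        X.s.Y.meet_mono)
        simp_all
    also have "\<dots> = ?\<phi> (rect (a \<sqinter>\<^bsub>frm K\<^esub> down b) (up a \<sqinter>\<^bsub>frm K\<^esub> b))"
      using a b by (simp add: \<phi>_rect frame_homD(3)[OF h'])
    finally show ?thesis .
  qed
  note factor = saturation_factor[OF X.frames(2) \<phi> this]
  interpret Y: roc_locale "induced_relation K" by (rule roc_locale_induced)
  have o: "opens (induced_relation K) = frm K" "rel_map (induced_relation K) = sat"
    by (simp_all add: induced_relation_def)
  have "restrict ?\<phi> (saturated K) (source (induced_relation K) x) = source X (h x) \<and>
      restrict ?\<phi> (saturated K) (target (induced_relation K) x) = target X (h x)"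
    if x: "x \<in> carrier (frm K)" for x
    using x factor(2) source_target_saturated[OF x]
    by (simp add: Y.source_eq Y.target_eq o ideal_inj1 ideal_inj2 \<phi>1 \<phi>2)
  then have "\<forall>x\<in>carrier (frm K).
      restrict ?\<phi> (saturated K) (source (induced_relation K) x) = source X (h x) \<and>
      restrict ?\<phi> (saturated K) (target (induced_relation K) x) = target X (h x)" by blast
  then show ?thesis
    unfolding monotone_maps_iff[OF X.localic_relation localic_relation_induced] o
    using h' factor(1) by blast
qed

end

section \<open>Functoriality and the adjunction\<close>

lemma cat_functor_cone: "cat_functor rocLoc (op_cat ConFrm) cone"
proof -
  interpret C: category rocLoc by (rule category_rocLoc)
  interpret D: category "op_cat ConFrm" by (rule category_op_cat[OF category_ConFrm])
  have roc: "roc_locale X" if "X \<in> Obj rocLoc" for X :: "('a, 'r) rel_locale"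
    using that by (simp add: rocLoc_def roc_locale_def localic_rel_def roc_locale_axioms_def)
  show ?thesis
  proof (unfold_locales, goal_cases)
    case (1 X)
    then show ?case using roc_locale.conic_frame_cone[OF roc] by (simp add: op_cat_def ConFrm_def)
  next
    case (2 X Y f)
    then have "f \<in> conic_hom (fobj cone Y) (fobj cone X)"
      by (intro monotone_map_conic_hom roc) (simp_all add: rocLoc_def)
    then show ?case by (simp add: op_cat_def ConFrm_def) (simp add: cone_def)
  qed (simp_all add: rocLoc_def op_cat_def ConFrm_def cone_def)
qed

lemma cat_functor_rel: "cat_functor (op_cat ConFrm) rocLoc rel"
proof -
  interpret C: category rocLoc by (rule category_rocLoc)
  interpret D: category "op_cat ConFrm" by (rule category_op_cat[OF category_ConFrm])
  have conic: "conic K" if "K \<in> Obj (op_cat ConFrm)" for K :: "'a conic_frame"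
    using that by unfold_locales (simp add: op_cat_def ConFrm_def)
  show ?thesis
  proof (unfold_locales, goal_cases)
    case (1 K)
    then interpret conic K by (rule conic)
    interpret X: roc_locale "induced_relation K" by (rule roc_locale_induced)
    show ?case using X.localic_relation X.open_cones by (simp add: rel_def rocLoc_def)
  next
    case (2 K J f)
    interpret K: conic K using 2 conic by blast
    interpret J: conic J using 2 conic by blast
    have "f \<in> conic_hom J K" using 2 by (simp add: op_cat_def ConFrm_def)
    \<comment> \<open>As \<open>K\<close> is the conic frame of cones of its induced relation,
      \<open>f\<close> is conic into \<open>fobj cone (induced_relation K)\<close> and can be
      transposed.\<close>
    then have "f \<in> monotone_maps (induced_relation K) (induced_relation J)"
      by (intro J.conic_hom_monotone_map K.roc_locale_induced) (simp add: K.cone_induced)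
    then show ?case by (simp add: rel_def rocLoc_def)
  qed (simp_all add: rocLoc_def op_cat_def ConFrm_def rel_def induced_relation_def)
qed

lemma cat_functor_comp_fun:
  assumes "cat_functor C D F" "cat_functor D E G"
  shows "cat_functor C E (comp_fun G F)"
proof -
  interpret F: cat_functor C D F by fact
  interpret G: cat_functor D E G by fact
  show ?thesis
  proof (unfold_locales, goal_cases)
    case (4 X Y Z f g)
    then show ?case
      using G.fmap_Comp[of "fobj F X" "fobj F Y" "fobj F Z" "fmap F X Y f" "fmap F Y Z g"]
      by (simp add: comp_fun_def F.fmap_Comp F.fmap_in_Hom F.fobj_in_Obj)
  qed (simp_all add: comp_fun_def F.fobj_in_Obj F.fmap_in_Hom F.fmap_Ident G.fobj_in_Obj
    G.fmap_in_Hom G.fmap_Ident)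
qed

lemma cat_functor_id_fun: "category C \<Longrightarrow> cat_functor C C id_fun"
  by (simp add: cat_functor_def cat_functor_axioms_def id_fun_def)

theorem theorem8p3:
  shows "functor_eq (op_cat ConFrm :: ('a conic_frame, 'a \<Rightarrow> 'a) category)
           (comp_fun cone rel) id_fun \<and>
         (\<exists>\<eta>. adjunction (rocLoc :: (('a, ('a \<times> 'a) set) rel_locale, 'a \<Rightarrow> 'a) category)
           (op_cat ConFrm) cone rel \<eta> (Ident (op_cat ConFrm)))"
proof (intro conjI exI)
  let ?C = "rocLoc :: (('a, ('a \<times> 'a) set) rel_locale, 'a \<Rightarrow> 'a) category"
  let ?D = "op_cat ConFrm :: ('a conic_frame, 'a \<Rightarrow> 'a) category"
  interpret C: category ?C by (rule category_rocLoc)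
  interpret D: category ?D by (rule category_op_cat[OF category_ConFrm])
  interpret F: cat_functor ?C ?D cone by (rule cat_functor_cone)
  interpret G: cat_functor ?D ?C rel by (rule cat_functor_rel)
  have cone_rel: "fobj cone (fobj rel K) = K" if "K \<in> Obj ?D" for K
  proof -
    interpret conic K using that by unfold_locales (simp add: op_cat_def ConFrm_def)
    show ?thesis using cone_induced by (simp add: rel_def)
  qed
  have maps [simp]: "fmap cone X Y h = h" "fmap rel K J h = h" for X Y K J and h :: "'a \<Rightarrow> 'a"
    by (simp_all add: cone_def rel_def)
  show "functor_eq ?D (comp_fun cone rel) id_fun"
    by (simp add: functor_eq_def comp_fun_def id_fun_def cone_rel)
  have unit: "nat_trans ?C ?C id_fun (comp_fun rel cone) (Ident ?C)"
  proof (intro nat_trans.intro nat_trans_axioms.intro, goal_cases)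
    case 1 show ?case by (rule cat_functor_id_fun[OF C.category_axioms])
  next
    case 2 show ?case by (rule cat_functor_comp_fun[OF F.cat_functor_axioms G.cat_functor_axioms])
  next
    case (3 X)
    interpret X: roc_locale X
      using 3 by (simp add: rocLoc_def roc_locale_def localic_rel_def roc_locale_axioms_def)
    interpret K: conic "fobj cone X" by unfold_locales (rule X.conic_frame_cone)
    \<comment> \<open>The unit is the transpose of the identity of \<open>fobj cone X\<close>. Its
      monotonicity says that the relation of \<open>X\<close> is contained in the one induced by its
      cones.\<close>
    have "Ident ?C X \<in> conic_hom (fobj cone X) (fobj cone X)"
      using id_conic_hom[OF K.conic_frame] by (simp add: rocLoc_def cone_def)
    then have "Ident ?C X \<in> monotone_maps X (induced_relation (fobj cone X))"
      by (rule K.conic_hom_monotone_map[OF X.roc_locale_axioms])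
    then show ?case by (simp add: comp_fun_def id_fun_def rel_def) (simp add: rocLoc_def)
  next
    case (4 X Y f)
    then have "f \<in> carrier (opens Y) \<rightarrow>\<^sub>E carrier (opens X)"
      by (auto simp: rocLoc_def monotone_maps_def frame_hom_def)
    then show ?case
      by (intro ext) (auto simp: rocLoc_def comp_fun_def id_fun_def cone_def rel_def
        induced_relation_def compose_def restrict_def PiE_iff extensional_def)
  qed
  have counit: "nat_trans ?D ?D (comp_fun cone rel) id_fun (Ident ?D)"
  proof (intro nat_trans.intro nat_trans_axioms.intro, goal_cases)
    case 1 show ?case by (rule cat_functor_comp_fun[OF G.cat_functor_axioms F.cat_functor_axioms])
  next
    case 2 show ?case by (rule cat_functor_id_fun[OF D.category_axioms])
  next
    case (3 K) then show ?case by (simp add: comp_fun_def id_fun_def cone_rel D.Ident_in_Hom)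
  next
    case (4 K J f) then show ?case
      by (simp add: comp_fun_def id_fun_def cone_rel D.Comp_Ident_left D.Comp_Ident_right)
  qed
  show "adjunction ?C ?D cone rel (Ident ?C) (Ident ?D)"
  proof (intro adjunction.intro adjunction_axioms.intro unit counit F.cat_functor_axioms
    G.cat_functor_axioms, goal_cases)
    case (1 X)
    \<comment> \<open>Identities on both sides are the restricted identity function of the same
      frame, so the triangle reduces to a composite of two identities.\<close>
    have "Ident ?C X = Ident ?D (fobj cone X)"
      by (simp add: rocLoc_def op_cat_def ConFrm_def cone_def)
    with 1 show ?case
      using D.Comp_Ident_left[of "fobj cone X" "fobj cone X" "Ident ?D (fobj cone X)"]
      by (simp add: cone_rel F.fobj_in_Obj D.Ident_in_Hom)
  next
    case (2 K)
    have "Ident ?D K = Ident ?C (fobj rel K)"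
      by (simp add: rocLoc_def op_cat_def ConFrm_def rel_def induced_relation_def)
    with 2 show ?case
      using C.Comp_Ident_left[of "fobj rel K" "fobj rel K" "Ident ?C (fobj rel K)"]
      by (simp add: cone_rel G.fobj_in_Obj C.Ident_in_Hom)
  qed
qed

end
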